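(* Let $\delta p\in\mathbb{R}^3$ be a prescribed displacement. Any minimizer $\xi\in H^1_\sharp(I,\mathbb{R}^3)$ of the energy functional $$\mathcal{G}(\xi)=\sum_{i=1}^{3}\mathfrak{g}_i\int_I(\dot\xi(t)\cdot\hat\tau_i)^2\,dt$$ subject to the constraint $$\sum_{i=1}^{3}\Big(\mathfrak{h}_i\,\hat\tau_i\cdot\int_I\xi(t)\times\dot\xi(t)\,dt\Big)e_i=\delta p$$ is of the type $$\xi(t):=(\cos t)\,u+(\sin t)\,v,$$ i.e. an ellipse of $\mathbb{R}^3$ centered at the origin and contained in the plane spanned by the vectors $u$ and $v$. The vectors $u,v\in\mathbb{R}^3$ are determined as follows. (1) We compute the vector $\omega$ via the relation $$\omega:=\mathrm{diag}\Big(\frac{\sqrt{\mathfrak{g}\,\mathfrak{g}_\theta}}{\mathfrak{h}},\frac{\sqrt{\mathfrak{g}\,\mathfrak{g}_\theta}}{\mathfrak{h}},\frac{\mathfrak{g}}{\mathfrak{h}_\theta}\Big)\delta p ,$$ where $\mathfrak{g}_1=\mathfrak{g}_2=\mathfrak{g}$, $\mathfrak{g}_3=\mathfrak{g}_\theta$, and similarly $\mathfrak{h}_1=\mathfrak{h}_2=\mathfrak{h}$, $\mathfrak{h}_3=\mathfrak{h}_\theta$. We then consider a vector $\sigma\in\mathbb{R}^3$ in the plane orthogonal to $\omega$ and such that $|\sigma|^2=|\omega|$, e.g. $\sigma:=\sqrt{|\omega|}\,\frac{\mu\times\omega}{|\mu\times\omega|}$, with $\mu$ linearly independent from $\omega$.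 (2) We set $\hat\omega:=\omega/|\omega|$ and compute the vectors $u$ and $v$ via the relations $$u:=\frac{U\Lambda_{\mathfrak{g}}^{-1/2}}{\sqrt{2\pi}}\,\sigma,\qquad v:=\frac{U\Lambda_{\mathfrak{g}}^{-1/2}}{\sqrt{2\pi}}\,(\sigma\times\hat\omega).$$ We then have $v\times u=\omega$, and the minimum value of $\mathcal{G}$ is equal to $|\omega|$. Moreover, the vectors $u$ and $v$ are $\mathfrak{g}$-orthogonal, i.e. orthogonal with respect to the inner product defined for every $a,b\in\mathbb{R}^3$ by $(a,b)_{\mathfrak{g}}:=2\pi\,\Lambda_{\mathfrak{g}}a\cdot b$, and have the same $\mathfrak{g}$-norm: $|u|_{\mathfrak{g}}^2=|v|_{\mathfrak{g}}^2=|\omega|$.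
   Context: $I=[0,2\pi]$. $H^1_\sharp(I,\mathbb{R}^3)$ is the Sobolev space of $2\pi$-periodic functions in $L^2(I,\mathbb{R}^3)$ having first order weak derivative in $L^2(I,\mathbb{R}^3)$. $(e_1,e_2,e_3)$ is the standard basis of $\mathbb{R}^3$, $\cdot$ and $\times$ are the usual dot and cross products, and $|\cdot|$ is the Euclidean norm. Vectors: $\tau_1:=(0,-1,1)$, $\tau_2:=\frac{1}{\sqrt3}(-2,1,1)$, $\tau_3:=(1,1,1)$, an orthogonal basis of $\mathbb{R}^3$; $\hat\tau_i:=\tau_i/|\tau_i|$; $U:=[\hat\tau_1|\hat\tau_2|\hat\tau_3]$ is the orthogonal matrix with these columns. Energy coefficients: $h,\kappa\in\mathbb{R}$ are parameters with $\kappa>\max(h,-2h)$; $\mathfrak{g}_1=\mathfrak{g}_2:=\kappa-h$, $\mathfrak{g}_3:=\kappa+2h$ (all positive); $\Lambda_{\mathfrak{g}}:=\mathrm{diag}(\mathfrak{g}_1,\mathfrak{g}_2,\mathfrak{g}_3)$. These are the eigenvalues of the symmetric positive definite matrix $G=U\Lambda_{\mathfrak{g}}U^{\mathsf T}$ with diagonal entries $\kappa$ and off-diagonal entries $h$, and $\mathcal{G}(\xi)=\int_I G\dot\xi\cdot\dot\xi\,dt$. Constraint coefficients: $\alpha,\gamma$ are real constants (parameters of the control system of a three-sphere low-Reynolds-number swimmer, whose net displacement in position and orientation after a small stroke $\xi$ is $\delta p$), and $\mathfrak{h}_1,\mathfrak{h}_2,\mathfrak{h}_3$ are defined by $\mathfrak{h}_1/|\tau_1|=\mathfrak{h}_2/|\tau_2|=\alpha$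 and $\mathfrak{h}_3/|\tau_3|=\gamma$ (so $\mathfrak{h}_1=\mathfrak{h}_2$ because $|\tau_1|=|\tau_2|$). $|a|_{\mathfrak{g}}:=\sqrt{(a,a)_{\mathfrak{g}}}$ is the norm associated with the inner product $(\cdot,\cdot)_{\mathfrak{g}}$.
   Formalization: Minimizers have the stated form after subtracting their mean (constants are free); v×u=ω is stated in energy-orthonormal coordinates √(2π)Λ^{1/2}Uᵀ, and g-orthogonality and g-norms for Uᵀu, Uᵀv, since the literal Cartesian claims fail (det U=−1); α,γ≠0 so that ω is defined. *)

theory Defs
  imports "HOL-Analysis.Analysis"
begin

unbundle cross3_syntax


section \<open>The periodic Sobolev space\<close>

abbreviation period :: "real measure" where
  "period \<equiv> lebesgue_on {0..2 * pi}"

definition square_integrable :: "(real \<Rightarrow> real^3) \<Rightarrow> bool" where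
  "square_integrable f \<longleftrightarrow>
     f \<in> borel_measurable period \<and> integrable period (\<lambda>t. (norm (f t))\<^sup>2)"

definition periodic :: "(real \<Rightarrow> 'b) \<Rightarrow> bool" where
  "periodic f \<longleftrightarrow> (\<forall>t. f (t + 2 * pi) = f t)"

definition test_function :: "(real \<Rightarrow> real) \<Rightarrow> bool" where
  "test_function \<phi> \<longleftrightarrow> periodic \<phi> \<and> (\<forall>n. (deriv ^^ n) \<phi> differentiable_on UNIV)"

text \<open>
  Weak differentiation of periodic functions is tested against all smooth \<^emph>\<open>periodic\<close> functions
  (not only those supported inside the open interval). This is the weak derivative on the circle:
  a jump between the two ends of the interval is not allowed.
\<close>

definition is_weak_deriv :: "(real \<Rightarrow> real^3) \<Rightarrow> (real \<Rightarrow> real^3) \<Rightarrow> bool" where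
  "is_weak_deriv \<xi> \<xi>' \<longleftrightarrow>
     (\<forall>\<phi>. test_function \<phi> \<longrightarrow>
        (LINT t|period. deriv \<phi> t *\<^sub>R \<xi> t) = - (LINT t|period. \<phi> t *\<^sub>R \<xi>' t))"

definition H1per :: "(real \<Rightarrow> real^3) set" where
  "H1per = {\<xi>. periodic \<xi> \<and> square_integrable \<xi> \<and>
                (\<exists>\<xi>'. square_integrable \<xi>' \<and> is_weak_deriv \<xi> \<xi>')}"

text \<open>
  The weak derivative is determined only almost everywhere; below it occurs only under integrals,
  so the choice of a representative is irrelevant.
\<close>

definition weak_deriv :: "(real \<Rightarrow> real^3) \<Rightarrow> real \<Rightarrow> real^3" where
  "weak_deriv \<xi> = (SOME \<xi>'. square_integrable \<xi>' \<and> is_weak_deriv \<xi> \<xi>')"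

definition mean :: "(real \<Rightarrow> real^3) \<Rightarrow> real^3" where
  "mean \<xi> = (1 / (2 * pi)) *\<^sub>R (LINT t|period. \<xi> t)"


section \<open>Coefficients of the swimmer\<close>

definition diag :: "real^3 \<Rightarrow> real^3^3" where
  "diag a = (\<chi> i j. if i = j then a $ i else 0)"

definition \<tau> :: "3 \<Rightarrow> real^3" where
  "\<tau> i = (vector [vector [0, -1, 1],
                   (1 / sqrt 3) *\<^sub>R vector [-2, 1, 1],
                   vector [1, 1, 1]] :: real^3^3) $ i"

definition \<tau>_hat :: "3 \<Rightarrow> real^3" where
  "\<tau>_hat i = (1 / norm (\<tau> i)) *\<^sub>R \<tau> i"

text \<open>The columns of \<open>U\<close> are the unit vectors \<open>\<tau>_hat\<close>; note that \<open>det U = - 1\<close>.\<close>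

definition U :: "real^3^3" where
  "U = (\<chi> i j. \<tau>_hat j $ i)"

definition \<gg> :: "real \<Rightarrow> real \<Rightarrow> real^3" where
  "\<gg> h \<kappa> = vector [\<kappa> - h, \<kappa> - h, \<kappa> + 2 * h]"

definition \<hh> :: "real \<Rightarrow> real \<Rightarrow> real^3" where
  "\<hh> \<alpha> \<gamma> = vector [\<alpha> * norm (\<tau> 1), \<alpha> * norm (\<tau> 2), \<gamma> * norm (\<tau> 3)]"


section \<open>The minimization problem\<close>

definition energy :: "real \<Rightarrow> real \<Rightarrow> (real \<Rightarrow> real^3) \<Rightarrow> real" where
  "energy h \<kappa> \<xi> = (\<Sum>i\<in>UNIV. \<gg> h \<kappa> $ i * (LINT t|period. (weak_deriv \<xi> t \<bullet> \<tau>_hat i)\<^sup>2))"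

definition displacement :: "real \<Rightarrow> real \<Rightarrow> (real \<Rightarrow> real^3) \<Rightarrow> real^3" where
  "displacement \<alpha> \<gamma> \<xi> =
     (\<Sum>i\<in>UNIV. (\<hh> \<alpha> \<gamma> $ i * (\<tau>_hat i \<bullet> (LINT t|period. \<xi> t \<times> weak_deriv \<xi> t))) *\<^sub>R axis i 1)"

definition admissible :: "real \<Rightarrow> real \<Rightarrow> real^3 \<Rightarrow> (real \<Rightarrow> real^3) set" where
  "admissible \<alpha> \<gamma> \<delta>p = {\<xi> \<in> H1per. displacement \<alpha> \<gamma> \<xi> = \<delta>p}"

definition is_minimizer ::
    "real \<Rightarrow> real \<Rightarrow> real \<Rightarrow> real \<Rightarrow> real^3 \<Rightarrow> (real \<Rightarrow> real^3) \<Rightarrow> bool" where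
  "is_minimizer h \<kappa> \<alpha> \<gamma> \<delta>p \<xi> \<longleftrightarrow>
     \<xi> \<in> admissible \<alpha> \<gamma> \<delta>p \<and> (\<forall>\<zeta>\<in>admissible \<alpha> \<gamma> \<delta>p. energy h \<kappa> \<xi> \<le> energy h \<kappa> \<zeta>)"


section \<open>The optimal ellipse\<close>

definition \<omega>_vec :: "real \<Rightarrow> real \<Rightarrow> real \<Rightarrow> real \<Rightarrow> real^3 \<Rightarrow> real^3" where
  "\<omega>_vec h \<kappa> \<alpha> \<gamma> \<delta>p =
     (let g = \<gg> h \<kappa> $ 1; g\<^sub>\<theta> = \<gg> h \<kappa> $ 3; k = \<hh> \<alpha> \<gamma> $ 1; k\<^sub>\<theta> = \<hh> \<alpha> \<gamma> $ 3
      in diag (vector [sqrt (g * g\<^sub>\<theta>) / k, sqrt (g * g\<^sub>\<theta>) / k, g / k\<^sub>\<theta>]) *v \<delta>p)"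

text \<open>If \<open>\<omega> = 0\<close> the only such vector is \<open>0\<close>.\<close>

definition generator :: "real^3 \<Rightarrow> real^3 \<Rightarrow> bool" where
  "generator \<omega> \<sigma> \<longleftrightarrow> \<sigma> \<bullet> \<omega> = 0 \<and> (norm \<sigma>)\<^sup>2 = norm \<omega>"

definition \<Lambda>_inv_sqrt :: "real \<Rightarrow> real \<Rightarrow> real^3^3" where
  "\<Lambda>_inv_sqrt h \<kappa> = diag (\<chi> i. 1 / sqrt (\<gg> h \<kappa> $ i))"

definition u_vec :: "real \<Rightarrow> real \<Rightarrow> real^3 \<Rightarrow> real^3" where
  "u_vec h \<kappa> \<sigma> = (1 / sqrt (2 * pi)) *\<^sub>R ((U ** \<Lambda>_inv_sqrt h \<kappa>) *v \<sigma>)"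

definition v_vec :: "real \<Rightarrow> real \<Rightarrow> real^3 \<Rightarrow> real^3 \<Rightarrow> real^3" where
  "v_vec h \<kappa> \<omega> \<sigma> =
     (1 / sqrt (2 * pi)) *\<^sub>R ((U ** \<Lambda>_inv_sqrt h \<kappa>) *v (\<sigma> \<times> ((1 / norm \<omega>) *\<^sub>R \<omega>)))"

definition ellipse :: "real^3 \<Rightarrow> real^3 \<Rightarrow> real \<Rightarrow> real^3" where
  "ellipse u v t = cos t *\<^sub>R u + sin t *\<^sub>R v"

text \<open>
  The form \<open>g_inner\<close> is diagonal, hence it acts on coordinates \<open>transpose U *v a\<close> with respect to
  the orthonormal basis \<open>\<tau>_hat\<close>. In terms of the vectors themselves it is
  \<open>2 * pi * (G *v a \<bullet> b)\<close> with \<open>G = U ** diag (\<gg> h \<kappa>) ** transpose U\<close>.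
\<close>

definition g_inner :: "real \<Rightarrow> real \<Rightarrow> real^3 \<Rightarrow> real^3 \<Rightarrow> real" where
  "g_inner h \<kappa> a b = 2 * pi * ((diag (\<gg> h \<kappa>) *v a) \<bullet> b)"

definition g_norm :: "real \<Rightarrow> real \<Rightarrow> real^3 \<Rightarrow> real" where
  "g_norm h \<kappa> a = sqrt (g_inner h \<kappa> a a)"

definition \<tau>_coords :: "real^3 \<Rightarrow> real^3" where
  "\<tau>_coords a = transpose U *v a"

text \<open>
  Coordinates with respect to the basis obtained from \<open>\<tau>_hat\<close> by normalizing it for the inner
  product above: they turn that inner product into the Euclidean one. For the optimal pair, \<open>\<omega>\<close> is
  the cross product of \<open>v\<close> and \<open>u\<close> computed in these coordinates; in Cartesian coordinates one has
  \<open>v \<times> u = - (1 / (2 * pi)) *\<^sub>R (U *v (D *v \<omega>))\<close>, where \<open>D\<close> is diagonal with entries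
  \<open>1 / sqrt (g * g\<^sub>\<theta>)\<close>, \<open>1 / sqrt (g * g\<^sub>\<theta>)\<close> and \<open>1 / g\<close>.
\<close>

definition g_coords :: "real \<Rightarrow> real \<Rightarrow> real^3 \<Rightarrow> real^3" where
  "g_coords h \<kappa> a =
     sqrt (2 * pi) *\<^sub>R (diag (\<chi> i. sqrt (\<gg> h \<kappa> $ i)) *v \<tau>_coords a)"

end

theory Submission
  imports Defs
begin

text \<open>
  In coordinates \<open>y\<close> that are orthonormal for the energy, the problem is the isoperimetric one: minimize
  \<open>\<integral> |y'|\<^sup>2\<close> for prescribed \<open>\<integral> y \<times> y'\<close>. For a unit vector \<open>n\<close> and mean-free \<open>y\<close>,
  \<open>n \<bullet> \<integral> y \<times> y' = \<integral> y' \<bullet> (n \<times> y) \<le> (\<integral> |y'|\<^sup>2 + \<integral> |y|\<^sup>2) / 2 \<le> \<integral> |y'|\<^sup>2\<close> by Wirtinger's inequality, and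
  equality forces \<open>y' = n \<times> y\<close>, whose periodic solutions are circles orthogonal to \<open>n\<close>.

  Fourier analysis uses the real basis \<open>cas (k t) = cos (k t) + sin (k t)\<close> with \<open>k\<close> ranging over all integers:
  it is orthogonal, and differentiation is \<open>k\<close> times the reflection \<open>k \<mapsto> - k\<close>. Weak derivatives are used
  only through their Fourier coefficients, so no continuous representative is needed.
\<close>

section \<open>Square integrable functions on the period\<close>

text \<open>The energy and the vector area do not change when a constant is added to
  \<open>\<xi>\<close>, because a periodic derivative has mean zero; minimizers are therefore
  identified after subtracting \<open>mean \<xi>\<close>, and only almost everywhere. The map
  \<open>g_coords\<close> stretches the frame \<open>\<tau>_hat\<close> diagonally. It puts the same
  factor 2 pi on the energy and on the area, which cancels in the comparison, and it transforms
  cross products by the cofactors of the stretching; these cofactors divided by \<open>\<hh>\<close>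
  are the weights in \<open>\<omega>_vec\<close>. Since the frame has determinant -1, the area
  prescribed in these coordinates is a negative multiple of \<omega>. Hence the inequality is
  applied with n opposite to \<omega>, and rotation about this n reproduces the formula for v.
  Completeness of the system \<open>cas (k t)\<close> rests on Stone-Weierstrass on the circle;
  Wirtinger's inequality then needs only finite sums and one approximation, no infinite
  series.\<close>

definition sq_int :: "(real \<Rightarrow> real) \<Rightarrow> bool" where
  "sq_int f \<longleftrightarrow> f \<in> borel_measurable period \<and> integrable period (\<lambda>t. (f t)\<^sup>2)"

lemma continuous_integrable_period:
  fixes f :: "real \<Rightarrow> 'a::euclidean_space"
  assumes "continuous_on {0..2*pi} f"
  shows "integrable period f"
  using continuous_imp_integrable_real[OF assms] .

lemma has_integral_imp_LINT_period:
  fixes f :: "real \<Rightarrow> 'a::euclidean_space"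
  assumes "continuous_on {0..2*pi} f" "(f has_integral I) {0..2*pi}"
  shows "(LINT t|period. f t) = I"
  using lebesgue_integral_eq_integral[OF continuous_integrable_period[OF assms(1)]] assms(2)
  by (simp add: integral_unique)

lemma continuous_sq_int:
  assumes "continuous_on {0..2*pi} f"
  shows "sq_int f"
  using continuous_integrable_period[OF assms]
    continuous_integrable_period[OF continuous_on_power[OF assms, of 2]]
  by (auto simp: sq_int_def intro: borel_measurable_integrable)

lemma sq_int_mult_integrable:
  assumes "sq_int f" "sq_int g"
  shows "integrable period (\<lambda>t. f t * g t)"
proof (rule Bochner_Integration.integrable_bound)
  show "integrable period (\<lambda>t. (f t)\<^sup>2 + (g t)\<^sup>2)"
    using assms by (simp add: sq_int_def)
  show "(\<lambda>t. f t * g t) \<in> borel_measurable period"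
    using assms unfolding sq_int_def by (intro borel_measurable_times) auto
  have "\<bar>f t * g t\<bar> \<le> (f t)\<^sup>2 + (g t)\<^sup>2" for t
    using sum_squares_bound[of "\<bar>f t\<bar>" "\<bar>g t\<bar>"] mult_nonneg_nonneg[of "\<bar>f t\<bar>" "\<bar>g t\<bar>"]
    unfolding abs_mult power2_abs by linarith
  then show "AE t in period. norm (f t * g t) \<le> norm ((f t)\<^sup>2 + (g t)\<^sup>2)"
    by simp
qed

lemma sq_int_const: "sq_int (\<lambda>t. c)"
  by (intro continuous_sq_int continuous_intros)

lemma sq_int_integrable:
  assumes "sq_int f" shows "integrable period f"
  using sq_int_mult_integrable[OF assms sq_int_const[of 1]] by simp

lemma sq_int_add:
  assumes "sq_int f" "sq_int g" shows "sq_int (\<lambda>t. f t + g t)"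
  using assms sq_int_mult_integrable[OF assms]
  by (auto simp: sq_int_def power2_sum mult.assoc)

lemma sq_int_cmult:
  assumes "sq_int f" shows "sq_int (\<lambda>t. c * f t)"
  using assms by (auto simp: sq_int_def power_mult_distrib)

lemma sq_int_diff:
  assumes "sq_int f" "sq_int g" shows "sq_int (\<lambda>t. f t - g t)"
  using sq_int_add[OF assms(1) sq_int_cmult[OF assms(2), of "-1"]] by simp

lemma sq_int_bound:
  assumes "sq_int w" "f \<in> borel_measurable period" "\<And>t. \<bar>f t\<bar> \<le> \<bar>w t\<bar>"
  shows "sq_int f"
  unfolding sq_int_def
proof (intro conjI assms)
  show "integrable period (\<lambda>t. (f t)\<^sup>2)"
  proof (rule Bochner_Integration.integrable_bound)
    show "integrable period (\<lambda>t. (w t)\<^sup>2)"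
      using assms by (simp add: sq_int_def)
  qed (use assms in \<open>auto simp: abs_le_square_iff\<close>)
qed

lemma LINT_square_diff:
  assumes "sq_int f" "sq_int g"
  shows "(LINT t|period. (f t - g t)\<^sup>2) =
         (LINT t|period. (f t)\<^sup>2) - 2 * (LINT t|period. f t * g t) + (LINT t|period. (g t)\<^sup>2)"
  using assms sq_int_mult_integrable[OF assms]
  by (simp add: sq_int_def power2_diff mult.assoc)

lemma LINT_period_const: "(LINT t|period. c) = (2 * pi) *\<^sub>R c"
  for c :: "'a::euclidean_space"
  by (rule has_integral_imp_LINT_period) (auto intro: continuous_intros has_integral_const_real[of c 0 "2*pi", simplified])

section \<open>Trigonometric polynomials\<close>

text \<open>The kernel of the Hartley transform. The derivative of \<open>cas\<close> at x is
  \<open>cas (- x)\<close>, so differentiation stays inside one real family.\<close>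

definition cas :: "real \<Rightarrow> real" where
  "cas x = cos x + sin x"

lemma cas_zero [simp]: "cas 0 = 1"
  by (simp add: cas_def)

lemma cos_eq_cas: "cos x = (cas x + cas (- x)) / 2"
  by (simp add: cas_def)

lemma sin_eq_cas: "sin x = (cas x - cas (- x)) / 2"
  by (simp add: cas_def)

lemma cas_mult: "cas x * cas y = cos (x - y) + sin (x + y)"
  by (simp add: cas_def cos_diff sin_add algebra_simps)

lemma cas_has_field_derivative:
  "((\<lambda>t. cas (a * t)) has_field_derivative a * cas (- (a * t))) (at t within S)"
  unfolding cas_def by (auto intro!: derivative_eq_intros simp: algebra_simps)

lemma continuous_on_cas [continuous_intros]:
  fixes f :: "'a::t2_space \<Rightarrow> real"
  assumes "continuous_on S f"
  shows "continuous_on S (\<lambda>t. cas (f t))"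
  unfolding cas_def by (intro continuous_on_add continuous_on_cos continuous_on_sin assms)

lemma cas_int_periodic: "cas (of_int k * (t + 2 * pi)) = cas (of_int k * t)"
  using cos_int_2pin[of k] sin_int_2pin[of k]
  by (simp add: cas_def distrib_left cos_add sin_add mult.commute mult.left_commute)

lemma LINT_cos_int:
  "(LINT t|period. cos (of_int k * t)) = (if k = 0 then 2 * pi else 0)"
proof (cases "k = 0")
  case False
  have "((\<lambda>t. cos (of_int k * t)) has_integral
        (sin (of_int k * (2 * pi)) / of_int k - sin (of_int k * 0) / of_int k)) {0..2*pi}"
    by (rule fundamental_theorem_of_calculus)
       (use False in \<open>auto intro!: derivative_eq_intros
          simp: has_real_derivative_iff_has_vector_derivative[symmetric]\<close>)
  then show ?thesis
    using has_integral_imp_LINT_period[of "\<lambda>t. cos (of_int k * t)"] False sin_int_2pin[of k]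
    by (simp add: continuous_intros mult.commute)
qed (use LINT_period_const[of "1::real"] in simp)

lemma LINT_sin_int: "(LINT t|period. sin (of_int k * t)) = 0"
proof (cases "k = 0")
  case False
  have "((\<lambda>t. sin (of_int k * t)) has_integral
        (- cos (of_int k * (2 * pi)) / of_int k - (- cos (of_int k * 0) / of_int k))) {0..2*pi}"
    by (rule fundamental_theorem_of_calculus)
       (use False in \<open>auto intro!: derivative_eq_intros
          simp: has_real_derivative_iff_has_vector_derivative[symmetric]\<close>)
  then show ?thesis
    using has_integral_imp_LINT_period[of "\<lambda>t. sin (of_int k * t)"] False cos_int_2pin[of k]
    by (simp add: continuous_intros mult.commute)
qed simp

text \<open>By \<open>cas_mult\<close> the product is a cosine of the difference frequency plus a
  sine of the sum frequency. The sine always integrates to zero, the cosine unless the frequencies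
  agree. Frequency 0 gets the same constant as all others.\<close>

lemma LINT_cas_mult:
  "(LINT t|period. cas (of_int k * t) * cas (of_int l * t)) = (if k = l then 2 * pi else 0)"
proof -
  have "(LINT t|period. cas (of_int k * t) * cas (of_int l * t)) =
        (LINT t|period. cos (of_int (k - l) * t) + sin (of_int (k + l) * t))"
    by (simp add: cas_mult algebra_simps)
  also have "\<dots> = (LINT t|period. cos (of_int (k - l) * t)) + (LINT t|period. sin (of_int (k + l) * t))"
    by (intro Bochner_Integration.integral_add continuous_integrable_period continuous_intros)
  finally show ?thesis
    by (simp only: LINT_cos_int LINT_sin_int) auto
qed

definition trig_sum :: "int set \<Rightarrow> (int \<Rightarrow> real) \<Rightarrow> real \<Rightarrow> real" where
  "trig_sum S c t = (\<Sum>k\<in>S. c k * cas (of_int k * t))"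

lemma continuous_on_trig_sum: "continuous_on A (trig_sum S c)"
  unfolding trig_sum_def by (intro continuous_intros)

lemma LINT_mult_trig_sum:
  assumes "finite S" "sq_int f"
  shows "(LINT t|period. f t * trig_sum S c t) =
         (\<Sum>k\<in>S. c k * (LINT t|period. f t * cas (of_int k * t)))"
proof -
  have "sq_int (\<lambda>t. cas (of_int k * t))" for k
    by (intro continuous_sq_int continuous_intros)
  then have "integrable period (\<lambda>t. f t * cas (of_int k * t))" for k
    using sq_int_mult_integrable[OF assms(2)] by blast
  moreover have "(LINT t|period. f t * trig_sum S c t) =
      (LINT t|period. (\<Sum>k\<in>S. c k * (f t * cas (of_int k * t))))"
    by (simp add: trig_sum_def sum_distrib_left algebra_simps)
  ultimately show ?thesis
    by (simp add: Bochner_Integration.integral_sum)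
qed

text \<open>Parseval's identity for finite sums; no infinite version is used.\<close>

lemma LINT_trig_sum_square:
  assumes "finite S"
  shows "(LINT t|period. (trig_sum S c t)\<^sup>2) = 2 * pi * (\<Sum>k\<in>S. (c k)\<^sup>2)"
proof -
  have 1: "sq_int (\<lambda>t. cas (of_int k * t))" for k
    by (intro continuous_sq_int continuous_intros)
  have 2: "(LINT t|period. trig_sum S c t * cas (of_int k * t)) = (if k \<in> S then 2 * pi * c k else 0)" for k
  proof -
    have "(LINT t|period. trig_sum S c t * cas (of_int k * t)) =
          (\<Sum>l\<in>S. c l * (LINT t|period. cas (of_int k * t) * cas (of_int l * t)))"
      using LINT_mult_trig_sum[OF assms 1] by (simp add: mult.commute)
    also have "\<dots> = (\<Sum>l\<in>S. if k = l then 2 * pi * c l else 0)"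
      by (intro sum.cong) (simp_all add: LINT_cas_mult)
    finally show ?thesis
      using assms by simp
  qed
  have "(LINT t|period. (trig_sum S c t)\<^sup>2) = (\<Sum>k\<in>S. c k * (2 * pi * c k))"
    unfolding power2_eq_square
    by (subst LINT_mult_trig_sum[OF assms continuous_sq_int[OF continuous_on_trig_sum]])
       (simp add: 2)
  then show ?thesis
    by (simp add: sum_distrib_left power2_eq_square algebra_simps)
qed

section \<open>Trigonometric polynomials form an algebra that is uniformly dense\<close>

definition trig_poly :: "(real \<Rightarrow> real) \<Rightarrow> bool" where
  "trig_poly p \<longleftrightarrow> (\<exists>S c. finite S \<and> p = trig_sum S c)"

lemma trig_poly_continuous: "trig_poly p \<Longrightarrow> continuous_on A p"
  by (auto simp: trig_poly_def continuous_on_trig_sum)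

lemma trig_poly_cas: "trig_poly (\<lambda>t. a * cas (of_int k * t))"
  unfolding trig_poly_def
  by (intro exI[of _ "{k}"] exI[of _ "\<lambda>_. a"]) (simp add: trig_sum_def fun_eq_iff)

lemma trig_poly_const: "trig_poly (\<lambda>t. a)"
  using trig_poly_cas[of a 0] by simp

lemma trig_poly_add:
  assumes "trig_poly p" "trig_poly q" shows "trig_poly (\<lambda>t. p t + q t)"
proof -
  obtain S c T d where S: "finite S" "p = trig_sum S c" and T: "finite T" "q = trig_sum T d"
    using assms by (auto simp: trig_poly_def)
  define b where "b k = (if k \<in> S then c k else 0) + (if k \<in> T then d k else 0)" for k
  have "trig_sum (S \<union> T) b t = p t + q t" for t
  proof -
    have "p t = (\<Sum>k\<in>S \<union> T. (if k \<in> S then c k else 0) * cas (of_int k * t))"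
      unfolding S trig_sum_def by (rule sum.mono_neutral_cong_left) (use S T in auto)
    moreover have "q t = (\<Sum>k\<in>S \<union> T. (if k \<in> T then d k else 0) * cas (of_int k * t))"
      unfolding T trig_sum_def by (rule sum.mono_neutral_cong_left) (use S T in auto)
    ultimately show ?thesis
      by (simp add: trig_sum_def b_def distrib_right sum.distrib)
  qed
  then show ?thesis
    using S T unfolding trig_poly_def by (intro exI[of _ "S \<union> T"] exI[of _ b]) auto
qed

lemma trig_poly_sum:
  assumes "\<And>k. k \<in> S \<Longrightarrow> trig_poly (p k)"
  shows "trig_poly (\<lambda>t. \<Sum>k\<in>S. p k t)"
  using assms by (induction S rule: infinite_finite_induct) (auto intro: trig_poly_add trig_poly_const)

lemma trig_poly_cos: "trig_poly (\<lambda>t. a * cos (of_int k * t))"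
  using trig_poly_add[OF trig_poly_cas[of "a/2" k] trig_poly_cas[of "a/2" "-k"]]
  by (simp add: cos_eq_cas field_simps)

lemma trig_poly_sin: "trig_poly (\<lambda>t. a * sin (of_int k * t))"
  using trig_poly_add[OF trig_poly_cas[of "a/2" k] trig_poly_cas[of "-a/2" "-k"]]
  by (simp add: sin_eq_cas field_simps)

lemma trig_poly_mult:
  assumes "trig_poly p" "trig_poly q" shows "trig_poly (\<lambda>t. p t * q t)"
proof -
  obtain S c T d where S: "p = trig_sum S c" and T: "q = trig_sum T d"
    using assms by (auto simp: trig_poly_def)
  have "p t * q t = (\<Sum>k\<in>S. \<Sum>l\<in>T. c k * d l * cos (of_int (k - l) * t) + c k * d l * sin (of_int (k + l) * t))" for t
  proof -
    have "p t * q t = (\<Sum>k\<in>S. \<Sum>l\<in>T. c k * d l * (cas (of_int k * t) * cas (of_int l * t)))"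
      by (simp add: S T trig_sum_def sum_product mult.assoc mult.left_commute)
    then show ?thesis
      by (simp add: cas_mult algebra_simps)
  qed
  then show ?thesis
    by (simp only:) (intro trig_poly_sum trig_poly_add trig_poly_cos trig_poly_sin)
qed

text \<open>Polynomial functions of the plane arise from linear functionals and constants by sums
  and products, and trigonometric polynomials form an algebra containing cosine and sine.\<close>

lemma trig_poly_polynomial_cis:
  assumes "real_polynomial_function p"
  shows "trig_poly (\<lambda>t. p (cis t))"
  using assms
proof (induction p rule: real_polynomial_function.induct)
  case (linear f)
  have "cis t = cos t *\<^sub>R 1 + sin t *\<^sub>R \<i>" for t
    by (simp add: complex_eq_iff)
  then have "f (cis t) = f 1 * cos (of_int 1 * t) + f \<i> * sin (of_int 1 * t)" for t
    by (simp add: linear_add linear_scale bounded_linear.linear[OF linear] mult.commute)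
  then show ?case
    using trig_poly_add[OF trig_poly_cos[of "f 1" 1] trig_poly_sin[of "f \<i>" 1]] by simp
qed (auto intro: trig_poly_add trig_poly_mult trig_poly_const)

text \<open>The function is transplanted to the unit circle, where Stone-Weierstrass gives a
  polynomial approximant; pulled back along \<open>cis\<close> it is a trigonometric
  polynomial.\<close>

lemma continuous_trig_poly_approx:
  fixes f :: "real \<Rightarrow> real"
  assumes f: "continuous_on {0..2*pi} f" "f 0 = f (2*pi)" and e: "0 < e"
  obtains p where "trig_poly p" "\<And>t. t \<in> {0..2*pi} \<Longrightarrow> \<bar>f t - p t\<bar> < e"
proof -
  \<comment> \<open>The angle of z in the interval from 0 to 2 pi: \<open>arccos (Re z)\<close> on
    the closed upper half circle, 2 pi minus it below.\<close>
  define F :: "complex \<Rightarrow> real" where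
    "F z = (if 0 \<le> Im z then f (arccos (Re z)) else f (2 * pi - arccos (Re z)))" for z
  define P where "P = sphere (0::complex) 1 \<inter> {z. 0 \<le> Im z}"
  define N where "N = sphere (0::complex) 1 \<inter> {z. Im z \<le> 0}"
  have Re: "- 1 \<le> Re z \<and> Re z \<le> 1" if "z \<in> sphere 0 1" for z
    using abs_Re_le_cmod[of z] that by auto
  have closed: "closed P" "closed N"
    unfolding P_def N_def by (intro closed_Int closed_sphere closed_halfspace_Im_ge closed_halfspace_Im_le)+
  have arccos: "continuous_on (sphere 0 1) (\<lambda>z. arccos (Re z))"
    using Re by (intro continuous_intros continuous_on_arccos) auto
  have "continuous_on P (\<lambda>z. f (arccos (Re z)))"
    by (rule continuous_on_compose2[OF f(1)])
       (use Re arccos_lbound arccos_ubound pi_ge_zero in \<open>force simp: P_def intro: continuous_on_subset[OF arccos]\<close>)+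
  moreover have "continuous_on N (\<lambda>z. f (2 * pi - arccos (Re z)))"
    by (rule continuous_on_compose2[OF f(1)])
       (use Re arccos_lbound arccos_ubound pi_ge_zero in
         \<open>force simp: N_def intro!: continuous_intros intro: continuous_on_subset[OF arccos]\<close>)+
  \<comment> \<open>The two closed arcs meet only at 1 and -1. At 1 the values agree because
    \<open>f 0 = f (2*pi)\<close>; at -1 both angles are pi.\<close>
  moreover have "f (arccos (Re z)) = f (2 * pi - arccos (Re z))" if "z \<in> P \<and> Im z \<le> 0 \<or> z \<in> N \<and> 0 \<le> Im z" for z
  proof -
    have "Im z = 0" "cmod z = 1"
      using that by (auto simp: P_def N_def)
    then have "Re z = 1 \<or> Re z = - 1"
      by (auto simp: cmod_def)
    then show ?thesis
      using f(2) by auto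
  qed
  ultimately have "continuous_on (P \<union> N) F"
    unfolding F_def using closed by (intro continuous_on_cases) (auto simp: P_def N_def)
  moreover have "P \<union> N = sphere 0 1"
    by (auto simp: P_def N_def)
  ultimately have "continuous_on (sphere 0 1) F"
    by simp
  then obtain q where q: "real_polynomial_function q" "\<And>z. z \<in> sphere 0 1 \<Longrightarrow> \<bar>F z - q z\<bar> < e"
    using Stone_Weierstrass_real_polynomial_function[OF compact_sphere] e by metis
  have "F (cis t) = f t" if "t \<in> {0..2*pi}" for t
  proof (cases "t \<le> pi")
    case True
    then show ?thesis
      using that by (simp add: F_def sin_ge_zero arccos_cos)
  next
    case False
    \<comment> \<open>At t = 2 pi the point lies in the branch \<open>0 \<le> Im z\<close>, where
      \<open>F\<close> returns \<open>f 0\<close>; the matching end values are used again.\<close>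
    then have "t = 2 * pi \<or> sin t < 0"
      using that sin_lt_zero[of t] by force
    moreover have "arccos (cos t) = 2 * pi - t"
      using False that arccos_cos[of "2 * pi - t"] by simp
    ultimately show ?thesis
      using f(2) by (auto simp: F_def)
  qed
  then show ?thesis
    using that[OF trig_poly_polynomial_cis[OF q(1)]] q(2) by (metis mem_sphere_0 norm_cis)
qed

section \<open>Density of trigonometric polynomials\<close>

definition trig_approximable :: "(real \<Rightarrow> real) \<Rightarrow> bool" where
  "trig_approximable f \<longleftrightarrow>
     (\<forall>e>0. \<exists>p. trig_poly p \<and> (LINT t|period. (f t - p t)\<^sup>2) < e)"

lemma trig_poly_sq_int: "trig_poly p \<Longrightarrow> sq_int p"
  by (intro continuous_sq_int trig_poly_continuous)

lemma continuous_trig_approximable: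
  fixes f :: "real \<Rightarrow> real"
  assumes f: "continuous_on {0..2*pi} f" "f 0 = f (2*pi)"
  shows "trig_approximable f"
  unfolding trig_approximable_def
proof (intro allI impI)
  fix e :: real assume e: "0 < e"
  \<comment> \<open>Chosen so that the square of d times the length 2 pi is e / 2.\<close>
  define d where "d = sqrt (e / (4 * pi))"
  have d: "0 < d"
    using e by (simp add: d_def)
  obtain p where p: "trig_poly p" "\<And>t. t \<in> {0..2*pi} \<Longrightarrow> \<bar>f t - p t\<bar> < d"
    using continuous_trig_poly_approx[OF f d] by blast
  have "(LINT t|period. (f t - p t)\<^sup>2) \<le> (LINT t|period. d\<^sup>2)"
  proof (rule integral_mono)
    show "(f t - p t)\<^sup>2 \<le> d\<^sup>2" if "t \<in> space period" for t
      using p(2)[of t] that by (simp add: abs_le_square_iff[symmetric])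
  qed (intro continuous_integrable_period continuous_intros f trig_poly_continuous p)+
  also have "\<dots> = e / 2"
    using e by (simp only: LINT_period_const) (simp add: d_def)
  finally show "\<exists>p. trig_poly p \<and> (LINT t|period. (f t - p t)\<^sup>2) < e"
    using p(1) e by force
qed

text \<open>Dominated convergence turns pointwise convergence into mean-square convergence, so
  approximability survives limits that have a common square integrable bound.\<close>

lemma trig_approximable_limit:
  assumes f: "f \<in> borel_measurable period" and w: "sq_int w"
    and g: "\<And>n. g n \<in> borel_measurable period" "\<And>n. trig_approximable (g n)"
    and bound: "\<And>n t. \<bar>g n t\<bar> \<le> \<bar>w t\<bar>" "\<And>t. \<bar>f t\<bar> \<le> \<bar>w t\<bar>"
    and lim: "AE t in period. (\<lambda>n. g n t) \<longlonglongrightarrow> f t"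
  shows "trig_approximable f"
  unfolding trig_approximable_def
proof (intro allI impI)
  fix e :: real assume e: "0 < e"
  have sq: "sq_int f" "sq_int (g n)" for n
    using sq_int_bound[OF w] f g bound by blast+
  have "(\<lambda>n. LINT t|period. (f t - g n t)\<^sup>2) \<longlonglongrightarrow> (LINT t|period. 0)"
  proof (rule integral_dominated_convergence)
    show "integrable period (\<lambda>t. 4 * (w t)\<^sup>2)"
      using w by (simp add: sq_int_def)
    show "AE t in period. (\<lambda>n. (f t - g n t)\<^sup>2) \<longlonglongrightarrow> 0"
      using lim
    proof eventually_elim
      case (elim t)
      then have "(\<lambda>n. (f t - g n t)\<^sup>2) \<longlonglongrightarrow> (f t - f t)\<^sup>2"
        by (intro tendsto_intros)
      then show ?case by simp
    qed
    show "AE t in period. norm ((f t - g n t)\<^sup>2) \<le> 4 * (w t)\<^sup>2" for n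
    proof (rule AE_I2)
      fix t
      have "\<bar>f t - g n t\<bar> \<le> \<bar>2 * w t\<bar>"
        using bound(1)[of n t] bound(2)[of t] by linarith
      then show "norm ((f t - g n t)\<^sup>2) \<le> 4 * (w t)\<^sup>2"
        unfolding abs_le_square_iff by (simp add: power_mult_distrib)
    qed
  qed (use sq_int_diff[OF sq] in \<open>auto simp: sq_int_def\<close>)
  \<comment> \<open>A quarter of e for each of the two errors, because the square of a sum is at
    most twice the sum of the squares.\<close>
  then have "eventually (\<lambda>n. (LINT t|period. (f t - g n t)\<^sup>2) < e / 4) sequentially"
    using e by (intro order_tendstoD(2)) auto
  then obtain n where n: "(LINT t|period. (f t - g n t)\<^sup>2) < e / 4"
    by (auto simp: eventually_sequentially)
  obtain p where p: "trig_poly p" "(LINT t|period. (g n t - p t)\<^sup>2) < e / 4"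
    using g(2)[of n] e unfolding trig_approximable_def by (meson divide_pos_pos zero_less_numeral)
  note ints = sq_int_diff[OF sq(1) sq(2)[of n]] sq_int_diff[OF sq(2)[of n] trig_poly_sq_int[OF p(1)]]
    sq_int_diff[OF sq(1) trig_poly_sq_int[OF p(1)]]
  have "(LINT t|period. (f t - p t)\<^sup>2) \<le>
      (LINT t|period. 2 * (f t - g n t)\<^sup>2 + 2 * (g n t - p t)\<^sup>2)"
  proof (rule integral_mono)
    show "(f t - p t)\<^sup>2 \<le> 2 * (f t - g n t)\<^sup>2 + 2 * (g n t - p t)\<^sup>2" for t
      using zero_le_power2[of "(f t - g n t) - (g n t - p t)"]
      by (simp add: power2_eq_square algebra_simps)
  qed (use ints in \<open>auto simp: sq_int_def\<close>)
  also have "\<dots> = 2 * (LINT t|period. (f t - g n t)\<^sup>2) + 2 * (LINT t|period. (g n t - p t)\<^sup>2)"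
    using ints by (simp add: sq_int_def)
  finally show "\<exists>p. trig_poly p \<and> (LINT t|period. (f t - p t)\<^sup>2) < e"
    using n p by force
qed

section \<open>From continuous to square integrable functions\<close>

definition clip :: "real \<Rightarrow> real \<Rightarrow> real" where
  "clip M x = max (- M) (min M x)"

lemma continuous_on_clip: "continuous_on S f \<Longrightarrow> continuous_on S (\<lambda>t. clip M (f t))"
  unfolding clip_def by (intro continuous_intros)

lemma clip_measurable:
  "f \<in> borel_measurable M \<Longrightarrow> (\<lambda>t. clip a (f t)) \<in> borel_measurable M"
  unfolding clip_def by (intro borel_measurable_max borel_measurable_min borel_measurable_const)

text \<open>Two limits: continuous functions reach the bounded truncations of f with a constant as
  the bound, and the truncations reach f with f itself as the bound.\<close>

lemma sq_int_trig_approximable: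
  assumes f: "sq_int f"
  shows "trig_approximable f"
proof -
  have meas: "f \<in> borel_measurable period"
    using f by (simp add: sq_int_def)
  then obtain N g where N: "negligible N" and g: "\<And>n. continuous_on UNIV (g n)"
    and lim: "\<And>t. t \<notin> N \<Longrightarrow> (\<lambda>n. g n t) \<longlonglongrightarrow> (if t \<in> {0..2*pi} then f t else 0)"
    using measurable_on_iff_borel_measurable[of "{0..2*pi}" f] unfolding measurable_on_def by auto
  have clip_approx: "trig_approximable (\<lambda>t. clip M (f t))" if M: "0 \<le> M" for M
  proof (rule trig_approximable_limit)
    \<comment> \<open>A cutoff that vanishes at 0 and 2 pi and tends to 1 in between; it forces
      equal end values on the continuous approximants. The \<open>max 0\<close> in \<open>q\<close>
      keeps the bound valid outside the period, where \<open>t * (2 * pi - t)\<close> is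
      negative.\<close>
    define r where "r n t = min 1 (real n * (t * (2 * pi - t)))" for n t
    define q where "q n t = clip M (g n t) * max 0 (r n t)" for n t
    have cont: "continuous_on {0..2*pi} (q n)" for n
      unfolding q_def r_def
      by (intro continuous_on_mult continuous_on_max continuous_on_min continuous_on_const continuous_on_diff
          continuous_on_id continuous_on_clip continuous_on_subset[OF g] subset_UNIV)
    show "trig_approximable (q n)" for n
      by (rule continuous_trig_approximable[OF cont]) (simp add: q_def r_def)
    show "q n \<in> borel_measurable period" for n
      using continuous_sq_int[OF cont] by (simp add: sq_int_def)
    show "(\<lambda>t. clip M (f t)) \<in> borel_measurable period"
      using meas by (rule clip_measurable)
    show "sq_int (\<lambda>t. M)"
      by (rule sq_int_const)
    have clip: "\<bar>clip M x\<bar> \<le> \<bar>M\<bar>" for x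
      using M by (auto simp: clip_def)
    then show "\<bar>clip M (f t)\<bar> \<le> \<bar>M\<bar>" for t .
    show "\<bar>q n t\<bar> \<le> \<bar>M\<bar>" for n t
      using mult_mono[OF clip[of "g n t"], of "max 0 (r n t)" 1]
      by (simp add: q_def r_def abs_mult)
    \<comment> \<open>At the end points the cutoff stays 0, so they join the exceptional null
      set.\<close>
    have "N \<union> {0, 2*pi} \<in> null_sets lebesgue"
      using N by (auto simp: negligible_iff_null_sets[symmetric])
    then have "AE t in lebesgue. t \<notin> N \<union> {0, 2*pi}"
      by (rule AE_not_in)
    then have "AE t in period. t \<notin> N \<union> {0, 2*pi}"
      by (subst AE_restrict_space_iff) (simp, erule eventually_mono, blast)
    moreover have "AE t in period. t \<in> {0..2*pi}"
      by (rule AE_I2) simp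
    ultimately show "AE t in period. (\<lambda>n. q n t) \<longlonglongrightarrow> clip M (f t)"
    proof eventually_elim
      case (elim t)
      then have t: "0 < t * (2 * pi - t)"
        by (intro mult_pos_pos) auto
      have "eventually (\<lambda>n. 1 \<le> real n * (t * (2 * pi - t))) sequentially"
        using eventually_ge_at_top[of "nat \<lceil>1 / (t * (2 * pi - t))\<rceil>"]
      proof eventually_elim
        case (elim n)
        then have "1 / (t * (2 * pi - t)) \<le> real n"
          by (simp only: nat_le_iff ceiling_le_iff of_int_of_nat_eq)
        then show ?case
          using t by (simp only: pos_divide_le_eq)
      qed
      then have "eventually (\<lambda>n. max 0 (r n t) = 1) sequentially"
        by eventually_elim (simp add: r_def)
      then have "(\<lambda>n. max 0 (r n t)) \<longlonglongrightarrow> 1"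
        by (rule tendsto_eventually)
      moreover have "(\<lambda>n. clip M (g n t)) \<longlonglongrightarrow> clip M (f t)"
        using lim[of t] elim unfolding clip_def by (intro tendsto_max tendsto_min tendsto_const) auto
      ultimately have "(\<lambda>n. clip M (g n t) * max 0 (r n t)) \<longlonglongrightarrow> clip M (f t) * 1"
        by (intro tendsto_mult)
      then show ?case
        by (simp add: q_def)
    qed
  qed
  show ?thesis
  proof (rule trig_approximable_limit[OF meas f])
    show "(\<lambda>t. clip (real n) (f t)) \<in> borel_measurable period" for n
      using meas by (rule clip_measurable)
    show "trig_approximable (\<lambda>t. clip (real n) (f t))" for n
      by (rule clip_approx) simp
    show "\<bar>clip (real n) (f t)\<bar> \<le> \<bar>f t\<bar>" for n t
      by (auto simp: clip_def)
    show "AE t in period. (\<lambda>n. clip (real n) (f t)) \<longlonglongrightarrow> f t"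
    proof (rule AE_I2)
      fix t
      have "eventually (\<lambda>n. \<bar>f t\<bar> \<le> real n) sequentially"
        using eventually_ge_at_top[of "nat \<lceil>\<bar>f t\<bar>\<rceil>"]
        by eventually_elim (simp only: nat_le_iff ceiling_le_iff of_int_of_nat_eq)
      then have "eventually (\<lambda>n. clip (real n) (f t) = f t) sequentially"
        by eventually_elim (auto simp: clip_def)
      then show "(\<lambda>n. clip (real n) (f t)) \<longlonglongrightarrow> f t"
        by (rule tendsto_eventually)
    qed
  qed simp
qed

text \<open>Such an f is orthogonal to every trigonometric polynomial p, so the squared norm of f -
  p is at least that of f; density makes it arbitrarily small.\<close>

lemma fourier_coefficients_zero_imp_AE_zero:
  assumes f: "sq_int f" and coeff: "\<And>k::int. (LINT t|period. f t * cas (of_int k * t)) = 0"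
  shows "AE t in period. f t = 0"
proof -
  have "(LINT t|period. (f t)\<^sup>2) \<le> e" if e: "0 < e" for e
  proof -
    obtain p where p: "trig_poly p" "(LINT t|period. (f t - p t)\<^sup>2) < e"
      using sq_int_trig_approximable[OF f] e
      unfolding trig_approximable_def by blast
    have "(LINT t|period. f t * p t) = 0"
      using p(1) by (auto simp: trig_poly_def LINT_mult_trig_sum[OF _ f] coeff)
    moreover have "0 \<le> (LINT t|period. (p t)\<^sup>2)"
      by simp
    ultimately show ?thesis
      using p(2) LINT_square_diff[OF f trig_poly_sq_int[OF p(1)]] by linarith
  qed
  then have "(LINT t|period. (f t)\<^sup>2) \<le> 0"
    by (metis add_0 field_le_epsilon)
  then have "(LINT t|period. (f t)\<^sup>2) = 0"
    by (intro antisym) simp_all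
  moreover have "integrable period (\<lambda>t. (f t)\<^sup>2)"
    using f by (simp add: sq_int_def)
  ultimately have "AE t in period. (f t)\<^sup>2 = 0"
    using integral_nonneg_eq_0_iff_AE[of period "\<lambda>t. (f t)\<^sup>2"] by simp
  then show ?thesis
    by eventually_elim simp
qed

text \<open>Duality replaces a termwise comparison of Fourier series. For an approximant p of f, the
  integral of f p is moved onto f' through an antiderivative q of the mean-free part of p. The norm
  of q is at most that of p, as nonzero integers have modulus at least 1. Expanding the squares of f
  - p and f' + q gives the inequality up to the approximation error.\<close>

lemma wirtinger_weak:
  assumes f: "sq_int f" and f': "sq_int f'"
    and weak: "\<And>k::int. of_int k * (LINT t|period. f t * cas (- (of_int k * t))) =
                 - (LINT t|period. f' t * cas (of_int k * t))"
    and mean: "(LINT t|period. f t) = 0"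
  shows "(LINT t|period. (f t)\<^sup>2) \<le> (LINT t|period. (f' t)\<^sup>2)"
proof (rule field_le_epsilon)
  fix e :: real assume "0 < e"
  then obtain S c where S: "finite S" and e: "(LINT t|period. (f t - trig_sum S c t)\<^sup>2) < e"
    using sq_int_trig_approximable[OF f] by (auto simp: trig_approximable_def trig_poly_def)
  \<comment> \<open>the antiderivative of the mean-free part of \<open>trig_sum S c\<close>\<close>
  define d where "d k = c (- k) / of_int k" for k
  define T where "T = uminus ` S - {0}"
  have T: "finite T"
    using S by (simp add: T_def)
  note sq = continuous_sq_int[OF continuous_on_trig_sum]
  have "(\<Sum>k\<in>T. (d k)\<^sup>2) \<le> (\<Sum>k\<in>T. (c (- k))\<^sup>2)"
  proof (rule sum_mono)
    fix k assume "k \<in> T"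
    then have "1 \<le> \<bar>real_of_int k\<bar>"
      by (auto simp: T_def simp flip: of_int_abs)
    then have "1 \<le> (real_of_int k)\<^sup>2"
      using one_le_power[of "\<bar>real_of_int k\<bar>" 2] by simp
    then show "(d k)\<^sup>2 \<le> (c (- k))\<^sup>2"
      by (simp add: d_def power_divide divide_le_eq mult_le_cancel_left1)
  qed
  also have "\<dots> = (\<Sum>k\<in>S - {0}. (c k)\<^sup>2)"
    by (rule sum.reindex_bij_witness[of _ uminus uminus]) (auto simp: T_def)
  also have "\<dots> \<le> (\<Sum>k\<in>S. (c k)\<^sup>2)"
    using S by (intro sum_mono2) auto
  finally have norms: "(LINT t|period. (trig_sum T d t)\<^sup>2) \<le> (LINT t|period. (trig_sum S c t)\<^sup>2)"
    using S T by (simp add: LINT_trig_sum_square)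
  have "(LINT t|period. f t * trig_sum S c t) = (\<Sum>k\<in>S. c k * (LINT t|period. f t * cas (of_int k * t)))"
    by (rule LINT_mult_trig_sum[OF S f])
  \<comment> \<open>Frequency 0, which has no periodic antiderivative, drops out because f has mean
    zero.\<close>
  also have "\<dots> = (\<Sum>k\<in>S - {0}. c k * (LINT t|period. f t * cas (of_int k * t)))"
    using S mean by (intro sum.mono_neutral_right) auto
  also have "\<dots> = (\<Sum>k\<in>T. - (d k * (LINT t|period. f' t * cas (of_int k * t))))"
  proof (rule sum.reindex_bij_witness[of _ uminus uminus])
    fix k assume "k \<in> S - {0}"
    then show "- (d (- k) * (LINT t|period. f' t * cas (of_int (- k) * t))) =
        c k * (LINT t|period. f t * cas (of_int k * t))"
      using weak[of "- k"] by (simp add: d_def field_simps)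
  qed (auto simp: T_def)
  also have "\<dots> = - (LINT t|period. f' t * trig_sum T d t)"
    by (simp add: LINT_mult_trig_sum[OF T f'] sum_negf)
  finally have "(LINT t|period. f t * trig_sum S c t) = - (LINT t|period. f' t * trig_sum T d t)" .
  moreover have "(LINT t|period. (f' t + trig_sum T d t)\<^sup>2) = (LINT t|period. (f' t)\<^sup>2)
      + 2 * (LINT t|period. f' t * trig_sum T d t) + (LINT t|period. (trig_sum T d t)\<^sup>2)"
    using LINT_square_diff[OF f' sq_int_cmult[OF sq, of "- 1" T d]] by simp
  \<comment> \<open>This stands in for Cauchy-Schwarz: it bounds -2 times the integral of f' q by
    the sum of the squared norms of f' and q.\<close>
  moreover have "0 \<le> (LINT t|period. (f' t + trig_sum T d t)\<^sup>2)"
    by simp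
  ultimately show "(LINT t|period. (f t)\<^sup>2) \<le> (LINT t|period. (f' t)\<^sup>2) + e"
    using LINT_square_diff[OF f sq, of S c] norms e by linarith
qed

section \<open>Vector-valued functions\<close>

lemma norm_square_Basis: "(norm x)\<^sup>2 = (\<Sum>c\<in>Basis. (c \<bullet> x)\<^sup>2)"
  for x :: "'a::euclidean_space"
  unfolding power2_norm_eq_inner
  by (subst euclidean_inner) (simp add: power2_eq_square inner_commute[of x])

text \<open>With c ranging over all vectors instead of a basis, stability under linear maps follows
  at once through the adjoint.\<close>

lemma square_integrable_iff: "square_integrable f \<longleftrightarrow> (\<forall>c. sq_int (\<lambda>t. c \<bullet> f t))"
proof
  assume f: "square_integrable f"
  show "\<forall>c. sq_int (\<lambda>t. c \<bullet> f t)"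
  proof
    fix c :: "real^3"
    have meas: "f \<in> borel_measurable period" and int: "integrable period (\<lambda>t. (norm (f t))\<^sup>2)"
      using f by (auto simp: square_integrable_def)
    have "sq_int (\<lambda>t. norm c * norm (f t))"
      using meas int by (intro sq_int_cmult) (simp add: sq_int_def)
    then show "sq_int (\<lambda>t. c \<bullet> f t)"
      using meas by (elim sq_int_bound)
        (auto intro!: borel_measurable_inner simp: Cauchy_Schwarz_ineq2 abs_mult)
  qed
next
  assume f: "\<forall>c. sq_int (\<lambda>t. c \<bullet> f t)"
  have "f \<in> borel_measurable period"
    using f by (subst borel_measurable_euclidean_space) (simp add: sq_int_def inner_commute[of "f _"])
  then show "square_integrable f"
    using f by (simp add: square_integrable_def sq_int_def norm_square_Basis)
qed

lemma square_integrable_component: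
  "square_integrable f \<Longrightarrow> sq_int (\<lambda>t. c \<bullet> f t)"
  by (simp add: square_integrable_iff)

lemma continuous_square_integrable:
  "continuous_on {0..2*pi} f \<Longrightarrow> square_integrable f"
  by (auto simp: square_integrable_iff intro!: continuous_sq_int continuous_intros)

lemma square_integrable_diff:
  "square_integrable f \<Longrightarrow> square_integrable g \<Longrightarrow> square_integrable (\<lambda>t. f t - g t)"
  by (simp add: square_integrable_iff inner_diff_right sq_int_diff)

lemma square_integrable_linear:
  assumes "square_integrable f" "linear L" shows "square_integrable (\<lambda>t. L (f t))"
proof -
  have "c \<bullet> L x = adjoint L c \<bullet> x" for c x
    using adjoint_works[OF assms(2), of x c] by (simp only: inner_commute)
  then show ?thesis
    using assms by (simp add: square_integrable_iff)
qed

lemma integrable_componentwise: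
  fixes f :: "real \<Rightarrow> real^3"
  assumes "\<And>c. integrable M (\<lambda>t. c \<bullet> f t)"
  shows "integrable M f"
proof -
  have "integrable M (\<lambda>t. \<Sum>c\<in>Basis. (c \<bullet> f t) *\<^sub>R c)"
    by (intro Bochner_Integration.integrable_sum integrable_scaleR_left assms)
  then show ?thesis
    by (simp add: euclidean_representation inner_commute[of _ "f _"])
qed

lemma square_integrable_integrable:
  assumes "square_integrable f" shows "integrable period f"
  using assms by (intro integrable_componentwise sq_int_integrable square_integrable_component)

lemma square_integrable_scaleR_integrable:
  assumes "square_integrable f" "sq_int \<phi>" shows "integrable period (\<lambda>t. \<phi> t *\<^sub>R f t)"
  using assms sq_int_mult_integrable square_integrable_component
  by (intro integrable_componentwise) simp

lemma square_integrable_inner_integrable: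
  assumes "square_integrable f" "square_integrable g"
  shows "integrable period (\<lambda>t. f t \<bullet> g t)"
proof -
  have "integrable period (\<lambda>t. \<Sum>c\<in>Basis. (c \<bullet> f t) * (c \<bullet> g t))"
    using assms by (intro Bochner_Integration.integrable_sum sq_int_mult_integrable square_integrable_component)
  then show ?thesis
    by (subst euclidean_inner) (simp add: inner_commute)
qed

lemma linear_cross_right: "linear (\<lambda>x. a \<times> x)"
  by (rule linearI) (simp_all add: cross_add_right cross_mult_right)

lemma square_integrable_cross_integrable:
  assumes "square_integrable f" "square_integrable g"
  shows "integrable period (\<lambda>t. f t \<times> g t)"
proof (rule integrable_componentwise)
  fix c :: "real^3"
  have "c \<bullet> (f t \<times> g t) = (c \<times> f t) \<bullet> g t" for t
    by (simp add: cross3_simps)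
  then show "integrable period (\<lambda>t. c \<bullet> (f t \<times> g t))"
    using square_integrable_inner_integrable[OF square_integrable_linear[OF assms(1) linear_cross_right] assms(2)]
    by simp
qed

lemma AE_eq_zero_componentwise:
  fixes f :: "real \<Rightarrow> real^3"
  assumes "\<And>c. AE t in M. c \<bullet> f t = 0"
  shows "AE t in M. f t = 0"
proof -
  have "AE t in M. \<forall>c\<in>Basis. c \<bullet> f t = 0"
    using assms by (intro AE_finite_allI) auto
  then show ?thesis
    by eventually_elim (metis euclidean_all_zero_iff inner_commute)
qed

section \<open>Weak derivatives in terms of Fourier coefficients\<close>

lemma deriv_cas: "deriv (\<lambda>t. b * cas (a * t)) = (\<lambda>t. b * a * cas (- a * t))"
  by (rule ext, rule DERIV_imp_deriv)
     (use DERIV_cmult[OF cas_has_field_derivative, of b a] in \<open>simp add: mult.assoc\<close>)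

text \<open>All iterated derivatives keep the shape \<open>b * cas (a * t)\<close>, which is what
  the induction carries.\<close>

lemma test_function_cas: "test_function (\<lambda>t. cas (of_int k * t))"
proof -
  have "\<exists>b a. (deriv ^^ n) (\<lambda>t. cas (of_int k * t)) = (\<lambda>t. b * cas (a * t))" for n
  proof (induction n)
    case 0
    show ?case
      by (intro exI[of _ 1] exI[of _ "of_int k"]) simp
  next
    case (Suc n)
    then obtain b a where "(deriv ^^ n) (\<lambda>t. cas (of_int k * t)) = (\<lambda>t. b * cas (a * t))"
      by blast
    then have "(deriv ^^ Suc n) (\<lambda>t. cas (of_int k * t)) = (\<lambda>t. b * a * cas (- a * t))"
      by (simp add: deriv_cas)
    then show ?case
      by blast
  qed
  moreover have "(\<lambda>t. b * cas (a * t)) differentiable_on UNIV" for a b :: real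
    using DERIV_cmult[OF cas_has_field_derivative, of b a]
    by (auto simp: differentiable_on_def real_differentiable_def)
  ultimately show ?thesis
    by (metis test_function_def periodic_def cas_int_periodic)
qed

text \<open>The weak derivative tested only against \<open>cas (k t)\<close>. By completeness this
  still determines \<open>f'\<close> almost everywhere, and it passes to linear images and to
  translates by constants without general test functions.\<close>

definition fourier_deriv :: "(real \<Rightarrow> real^3) \<Rightarrow> (real \<Rightarrow> real^3) \<Rightarrow> bool" where
  "fourier_deriv f f' \<longleftrightarrow> square_integrable f \<and> square_integrable f' \<and>
     (\<forall>k::int. of_int k *\<^sub>R (LINT t|period. cas (- (of_int k * t)) *\<^sub>R f t) =
        - (LINT t|period. cas (of_int k * t) *\<^sub>R f' t))"

lemma sq_int_cas: "sq_int (\<lambda>t. cas (a * t))" "sq_int (\<lambda>t. cas (- (a * t)))"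
  by (intro continuous_sq_int continuous_intros)+

lemma is_weak_deriv_imp_fourier_deriv:
  assumes "square_integrable f" "square_integrable f'" "is_weak_deriv f f'"
  shows "fourier_deriv f f'"
proof -
  have "of_int k *\<^sub>R (LINT t|period. cas (- (of_int k * t)) *\<^sub>R f t) =
      - (LINT t|period. cas (of_int k * t) *\<^sub>R f' t)" for k :: int
  proof -
    have "of_int k *\<^sub>R (LINT t|period. cas (- (of_int k * t)) *\<^sub>R f t) =
        (LINT t|period. deriv (\<lambda>t. cas (of_int k * t)) t *\<^sub>R f t)"
      using deriv_cas[of 1 "of_int k"] by (simp add: scaleR_scaleR[symmetric] del: scaleR_scaleR)
    then show ?thesis
      using assms(3) test_function_cas[of k] by (simp add: is_weak_deriv_def)
  qed
  then show ?thesis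
    using assms by (simp add: fourier_deriv_def)
qed

lemma inner_LINT_scaleR:
  assumes "square_integrable f" "sq_int \<phi>"
  shows "c \<bullet> (LINT t|period. \<phi> t *\<^sub>R f t) = (LINT t|period. (c \<bullet> f t) * \<phi> t)"
  using integral_inner_right[OF square_integrable_scaleR_integrable[OF assms], of c]
  by (simp add: mult.commute)

text \<open>Integration commutes with linear maps; this carries the derivative from
  \<open>\<xi>\<close> over to its adapted coordinates.\<close>

lemma fourier_deriv_linear:
  assumes "fourier_deriv f f'" "linear L"
  shows "fourier_deriv (\<lambda>t. L (f t)) (\<lambda>t. L (f' t))"
proof -
  have bl: "bounded_linear L"
    using assms(2) by (simp add: linear_conv_bounded_linear)
  have LL: "(LINT t|period. \<phi> t *\<^sub>R L (g t)) = L (LINT t|period. \<phi> t *\<^sub>R g t)"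
    if "square_integrable g" "sq_int \<phi>" for g \<phi>
    using integral_bounded_linear[OF bl square_integrable_scaleR_integrable[OF that]]
    by (simp add: linear_scale[OF assms(2)])
  show ?thesis
    unfolding fourier_deriv_def
  proof (intro conjI allI)
    fix k :: int
    have "of_int k *\<^sub>R L (LINT t|period. cas (- (of_int k * t)) *\<^sub>R f t) =
        L (of_int k *\<^sub>R (LINT t|period. cas (- (of_int k * t)) *\<^sub>R f t))"
      by (simp only: linear_scale[OF assms(2)])
    also have "\<dots> = - L (LINT t|period. cas (of_int k * t) *\<^sub>R f' t)"
      using assms(1) by (simp only: fourier_deriv_def linear_neg[OF assms(2)])
    finally show "of_int k *\<^sub>R (LINT t|period. cas (- (of_int k * t)) *\<^sub>R L (f t)) =
        - (LINT t|period. cas (of_int k * t) *\<^sub>R L (f' t))"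
      using assms(1) by (simp only: LL sq_int_cas fourier_deriv_def)
  qed (use assms square_integrable_linear in \<open>auto simp: fourier_deriv_def\<close>)
qed

text \<open>Completeness of the \<open>cas\<close> system, applied to each component of the
  difference. It makes the choice inside \<open>weak_deriv\<close> harmless: an explicit derivative
  may replace it under integrals.\<close>

lemma fourier_deriv_unique:
  assumes "fourier_deriv f f1" "fourier_deriv f f2"
  shows "AE t in period. f1 t = f2 t"
proof -
  have sq: "square_integrable f1" "square_integrable f2"
    using assms by (auto simp: fourier_deriv_def)
  have "AE t in period. f1 t - f2 t = 0"
  proof (rule AE_eq_zero_componentwise)
    fix c :: "real^3"
    show "AE t in period. c \<bullet> (f1 t - f2 t) = 0"
    proof (rule fourier_coefficients_zero_imp_AE_zero)
      show "sq_int (\<lambda>t. c \<bullet> (f1 t - f2 t))"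
        by (intro square_integrable_component square_integrable_diff sq)
      fix k :: int
      have "(LINT t|period. c \<bullet> (f1 t - f2 t) * cas (of_int k * t)) =
          c \<bullet> (LINT t|period. cas (of_int k * t) *\<^sub>R (f1 t - f2 t))"
        by (simp add: inner_LINT_scaleR square_integrable_diff sq sq_int_cas)
      also have "\<dots> = c \<bullet> ((LINT t|period. cas (of_int k * t) *\<^sub>R f1 t) - (LINT t|period. cas (of_int k * t) *\<^sub>R f2 t))"
        by (simp add: scaleR_diff_right square_integrable_scaleR_integrable sq sq_int_cas)
      also have "\<dots> = 0"
        using assms unfolding fourier_deriv_def by (metis (no_types, lifting) diff_self inner_zero_right neg_equal_iff_equal)
      finally show "(LINT t|period. c \<bullet> (f1 t - f2 t) * cas (of_int k * t)) = 0" .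
    qed
  qed
  then show ?thesis
    by simp
qed

text \<open>Frequency 0, that is, testing against the constant 1.\<close>

lemma fourier_deriv_mean_zero:
  assumes "fourier_deriv f f'" shows "(LINT t|period. f' t) = 0"
  using assms unfolding fourier_deriv_def by (auto dest: spec[of _ 0])

lemma LINT_cas: "(LINT t|period. cas (of_int k * t)) = (if k = 0 then 2 * pi else 0)"
  using LINT_cas_mult[of k 0] by simp

text \<open>Constants are orthogonal to \<open>cas (k t)\<close> for nonzero k, and at k = 0 the
  coefficient is multiplied by 0.\<close>

lemma fourier_deriv_diff_const:
  assumes "fourier_deriv f f'" shows "fourier_deriv (\<lambda>t. f t - a) f'"
proof -
  have sq: "square_integrable f" "square_integrable (\<lambda>t. a)"
    using assms by (auto simp: fourier_deriv_def intro: continuous_square_integrable)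
  have "of_int k *\<^sub>R (LINT t|period. cas (- (of_int k * t)) *\<^sub>R (f t - a)) =
      of_int k *\<^sub>R (LINT t|period. cas (- (of_int k * t)) *\<^sub>R f t)" for k :: int
  proof -
    have "(LINT t|period. cas (- (of_int k * t)) *\<^sub>R (f t - a)) =
        (LINT t|period. cas (- (of_int k * t)) *\<^sub>R f t) - (LINT t|period. cas (of_int (- k) * t)) *\<^sub>R a"
      using square_integrable_scaleR_integrable[OF sq(1) sq_int_cas(2)[of "of_int k"]]
        square_integrable_scaleR_integrable[OF sq(2) sq_int_cas(2)[of "of_int k"]]
        sq_int_integrable[OF sq_int_cas(2)[of "of_int k"]]
      by (simp add: scaleR_diff_right)
    then show ?thesis
      by (simp only: LINT_cas) auto
  qed
  then show ?thesis
    using assms sq by (simp only: fourier_deriv_def square_integrable_diff simp_thms)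
qed

lemma wirtinger_vector:
  assumes "fourier_deriv f f'" "(LINT t|period. f t) = 0"
  shows "(LINT t|period. (norm (f t))\<^sup>2) \<le> (LINT t|period. (norm (f' t))\<^sup>2)"
proof -
  have sq: "square_integrable f" "square_integrable f'"
    using assms by (auto simp: fourier_deriv_def)
  have norm: "(LINT t|period. (norm (g t))\<^sup>2) = (\<Sum>c\<in>Basis. LINT t|period. (c \<bullet> g t)\<^sup>2)"
    if "square_integrable g" for g
    using square_integrable_component[OF that] by (simp add: norm_square_Basis sq_int_def)
  have "(LINT t|period. (c \<bullet> f t)\<^sup>2) \<le> (LINT t|period. (c \<bullet> f' t)\<^sup>2)" for c
  proof (rule wirtinger_weak)
    show "sq_int (\<lambda>t. c \<bullet> f t)" "sq_int (\<lambda>t. c \<bullet> f' t)"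
      using sq by (auto intro: square_integrable_component)
    show "(LINT t|period. c \<bullet> f t) = 0"
      using integral_inner_right[OF square_integrable_integrable[OF sq(1)], of c] assms(2) by simp
    show "of_int k * (LINT t|period. c \<bullet> f t * cas (- (of_int k * t))) =
        - (LINT t|period. c \<bullet> f' t * cas (of_int k * t))" for k :: int
    proof -
      have "of_int k * (c \<bullet> (LINT t|period. cas (- (of_int k * t)) *\<^sub>R f t)) =
          - (c \<bullet> (LINT t|period. cas (of_int k * t) *\<^sub>R f' t))"
        using assms(1) unfolding fourier_deriv_def by (simp only: inner_minus_right flip: inner_scaleR_right)
      then show ?thesis
        by (simp only: inner_LINT_scaleR sq sq_int_cas)
    qed
  qed
  then show ?thesis
    by (simp add: norm sq sum_mono)
qed

section \<open>The isoperimetric inequality\<close>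

lemma norm_diff_orthogonal:
  assumes "x \<bullet> y = 0"
  shows "(norm (a *\<^sub>R x - b *\<^sub>R y))\<^sup>2 = a\<^sup>2 * (norm x)\<^sup>2 + b\<^sup>2 * (norm y)\<^sup>2"
  unfolding power2_norm_eq_inner
  using assms by (simp add: inner_diff_left inner_diff_right inner_commute[of y x] power2_eq_square)

lemma LINT_minus_mean:
  assumes "square_integrable y" shows "(LINT t|period. y t - mean y) = 0"
proof -
  have "(LINT t|period. y t - mean y) = (LINT t|period. y t) - (LINT t|period. mean y)"
    by (intro Bochner_Integration.integral_diff square_integrable_integrable assms
        continuous_square_integrable continuous_intros)
  also have "\<dots> = 0"
    by (simp only: LINT_period_const) (simp add: mean_def)
  finally show ?thesis .
qed

lemma isoperimetric:
  fixes y y' :: "real \<Rightarrow> real^3" and n :: "real^3"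
  assumes y: "fourier_deriv y y'" and n: "norm n = 1"
  defines "z \<equiv> (\<lambda>t. y t - mean y)"
  shows "n \<bullet> (LINT t|period. y t \<times> y' t) \<le> (LINT t|period. (norm (y' t))\<^sup>2)"
    and "n \<bullet> (LINT t|period. y t \<times> y' t) = (LINT t|period. (norm (y' t))\<^sup>2) \<Longrightarrow>
      AE t in period. y' t = n \<times> z t"
proof -
  have sq: "square_integrable y" "square_integrable y'"
    using y by (auto simp: fourier_deriv_def)
  have z: "fourier_deriv z y'"
    unfolding z_def by (rule fourier_deriv_diff_const[OF y])
  have sqz: "square_integrable z"
    using z by (simp add: fourier_deriv_def)
  have sqnz: "square_integrable (\<lambda>t. n \<times> z t)"
    by (rule square_integrable_linear[OF sqz linear_cross_right])
  have mean_z: "(LINT t|period. z t) = 0"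
    unfolding z_def by (rule LINT_minus_mean[OF sq(1)])
  \<comment> \<open>The deficit: its squared norm, expanded and integrated, contains the area with
    factor -2, so it yields both the inequality and the equality case.\<close>
  define D where "D t = y' t - n \<times> z t" for t
  have sqD: "square_integrable D"
    unfolding D_def by (intro square_integrable_diff sq sqnz)
  \<comment> \<open>Passing from \<open>y\<close> to \<open>z\<close> costs a fixed vector dotted
    with \<open>y'\<close>, and the integral of \<open>y'\<close> vanishes.\<close>
  have area: "n \<bullet> (LINT t|period. y t \<times> y' t) = (LINT t|period. y' t \<bullet> (n \<times> z t))"
  proof -
    have "n \<bullet> (LINT t|period. y t \<times> y' t) = (LINT t|period. n \<bullet> (y t \<times> y' t))"
      using integral_inner_right[OF square_integrable_cross_integrable[OF sq], of n] by simp
    also have "\<dots> = (LINT t|period. y' t \<bullet> (n \<times> z t) + (n \<times> mean y) \<bullet> y' t)"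
      by (rule Bochner_Integration.integral_cong) (simp_all add: z_def cross3_simps)
    also have "\<dots> = (LINT t|period. y' t \<bullet> (n \<times> z t)) + (LINT t|period. (n \<times> mean y) \<bullet> y' t)"
      by (intro Bochner_Integration.integral_add square_integrable_inner_integrable sq sqnz
          continuous_square_integrable) simp
    also have "(LINT t|period. (n \<times> mean y) \<bullet> y' t) = 0"
      using integral_inner_right[OF square_integrable_integrable[OF sq(2)], of "n \<times> mean y"]
        fourier_deriv_mean_zero[OF y] by simp
    finally show ?thesis by simp
  qed
  have "(LINT t|period. (norm (D t))\<^sup>2) = (LINT t|period. (norm (y' t))\<^sup>2 - 2 * (y' t \<bullet> (n \<times> z t)) + (norm (n \<times> z t))\<^sup>2)"
    by (rule Bochner_Integration.integral_cong)
       (simp_all add: D_def power2_norm_eq_inner inner_diff_left inner_diff_right inner_commute)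
  also have "\<dots> = (LINT t|period. (norm (y' t))\<^sup>2) - 2 * (LINT t|period. y' t \<bullet> (n \<times> z t)) + (LINT t|period. (norm (n \<times> z t))\<^sup>2)"
    using sq sqnz square_integrable_inner_integrable[OF sq(2) sqnz]
    by (simp add: square_integrable_def)
  finally have D: "(LINT t|period. (norm (D t))\<^sup>2) = (LINT t|period. (norm (y' t))\<^sup>2)
      - 2 * (n \<bullet> (LINT t|period. y t \<times> y' t)) + (LINT t|period. (norm (n \<times> z t))\<^sup>2)"
    by (simp only: area)
  have "(LINT t|period. (norm (n \<times> z t))\<^sup>2) \<le> (LINT t|period. (norm (z t))\<^sup>2)"
    using sqnz sqz by (intro integral_mono) (auto simp: square_integrable_def norm_cross n)
  also have "\<dots> \<le> (LINT t|period. (norm (y' t))\<^sup>2)"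
    by (rule wirtinger_vector[OF z mean_z])
  finally have le: "(LINT t|period. (norm (D t))\<^sup>2) \<le>
      2 * (LINT t|period. (norm (y' t))\<^sup>2) - 2 * (n \<bullet> (LINT t|period. y t \<times> y' t))"
    using D by simp
  moreover have nn: "0 \<le> (LINT t|period. (norm (D t))\<^sup>2)"
    by simp
  ultimately show "n \<bullet> (LINT t|period. y t \<times> y' t) \<le> (LINT t|period. (norm (y' t))\<^sup>2)"
    by linarith
  assume "n \<bullet> (LINT t|period. y t \<times> y' t) = (LINT t|period. (norm (y' t))\<^sup>2)"
  then have "(LINT t|period. (norm (D t))\<^sup>2) = 0"
    using le nn by linarith
  moreover have "integrable period (\<lambda>t. (norm (D t))\<^sup>2)"
    using sqD by (simp add: square_integrable_def)
  ultimately have "AE t in period. (norm (D t))\<^sup>2 = 0"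
    using integral_nonneg_eq_0_iff_AE[of period "\<lambda>t. (norm (D t))\<^sup>2"] by simp
  then show "AE t in period. y' t = n \<times> z t"
    by eventually_elim (simp add: D_def)
qed

text \<open>
  If the derivative is \<open>n \<times> z\<close>, the Fourier coefficients \<open>A k\<close> of \<open>z\<close> satisfy \<open>k A(-k) = - n \<times> A k\<close>,
  hence \<open>k\<^sup>2 A k = A k\<close> for \<open>k \<noteq> 0\<close>.
\<close>

lemma rotation_solution:
  fixes z z' :: "real \<Rightarrow> real^3" and n :: "real^3"
  assumes z: "fourier_deriv z z'" "(LINT t|period. z t) = 0" and n: "norm n = 1"
    and eq: "AE t in period. z' t = n \<times> z t"
  obtains a where "n \<bullet> a = 0" "AE t in period. z t = ellipse a (n \<times> a) t"
    "(LINT t|period. (norm (z' t))\<^sup>2) = 2 * pi * (norm a)\<^sup>2"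
proof -
  have sq: "square_integrable z" "square_integrable z'"
    using z by (auto simp: fourier_deriv_def)
  define A where "A k = (LINT t|period. cas (of_int k * t) *\<^sub>R z t)" for k :: int
  have rec: "of_int k *\<^sub>R A (- k) = - (n \<times> A k)" for k
  proof -
    have "(LINT t|period. cas (of_int k * t) *\<^sub>R z' t) = (LINT t|period. cas (of_int k * t) *\<^sub>R (n \<times> z t))"
    proof (rule integral_cong_AE)
      show "(\<lambda>t. cas (of_int k * t) *\<^sub>R z' t) \<in> borel_measurable period"
        using square_integrable_scaleR_integrable[OF sq(2) sq_int_cas(1)]
        by (rule borel_measurable_integrable)
      show "(\<lambda>t. cas (of_int k * t) *\<^sub>R (n \<times> z t)) \<in> borel_measurable period"
        using square_integrable_scaleR_integrable[OF square_integrable_linear[OF sq(1) linear_cross_right] sq_int_cas(1)]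
        by (rule borel_measurable_integrable)
    qed (use eq in eventually_elim, simp)
    also have "\<dots> = n \<times> A k"
      using integral_bounded_linear[OF linear_cross_right[of n, unfolded linear_conv_bounded_linear]
          square_integrable_scaleR_integrable[OF sq(1) sq_int_cas(1)], of "of_int k"]
      by (simp add: A_def cross_mult_right)
    finally show ?thesis
      using z(1) by (simp add: fourier_deriv_def A_def)
  qed
  have rec2: "(of_int k)\<^sup>2 *\<^sub>R A k = A k" if "k \<noteq> 0" for k
  proof -
    have nA: "of_int k *\<^sub>R A k = n \<times> A (- k)"
      using rec[of "- k"] by simp
    \<comment> \<open>A nonzero multiple of \<open>A k\<close> is a cross product with
      \<open>n\<close>. Orthogonality to \<open>n\<close> is what reduces n \<times> (n \<times> A
      k) to - A k.\<close>
    then have "of_int k * (n \<bullet> A k) = 0"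
      by (metis dot_cross_self(1) inner_scaleR_right)
    then have orth: "n \<bullet> A k = 0"
      using that by simp
    have "(of_int k)\<^sup>2 *\<^sub>R A k = of_int k *\<^sub>R (n \<times> A (- k))"
      by (simp add: power2_eq_square flip: nA)
    also have "\<dots> = - (n \<times> (n \<times> A k))"
      by (simp add: rec flip: cross_mult_right)
    also have "\<dots> = A k"
      using orth n by (simp add: Lagrange norm_eq_1)
    finally show ?thesis .
  qed
  have A0: "A k = 0" if "k \<noteq> 1" "k \<noteq> - 1" for k
  proof (cases "k = 0")
    case True
    then show ?thesis using z(2) by (simp add: A_def)
  next
    case False
    have "(of_int k)\<^sup>2 \<noteq> (1::real)"
      using that by (simp add: power2_eq_1_iff)
    then show ?thesis
      using rec2[OF False] by (metis scaleR_cancel_right scaleR_one)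
  qed
  have A1: "n \<times> A 1 = - A (- 1)"
    using rec[of 1] by simp
  have A2: "n \<times> A (- 1) = A 1"
    using rec[of "- 1"] by simp
  \<comment> \<open>Only the frequencies 1 and -1 survive; \<open>w\<close> below is their Fourier
    sum, with the squared norm 2 pi of \<open>cas\<close> divided out. \<open>a\<close> is the value
    of \<open>w\<close> at 0 and \<open>n \<times> a\<close> its derivative there.\<close>
  define a where "a = (1 / (2 * pi)) *\<^sub>R (A 1 + A (- 1))"
  have na: "n \<times> a = (1 / (2 * pi)) *\<^sub>R (A 1 - A (- 1))"
    by (simp add: A1 A2 a_def cross_mult_right cross_add_right)
  define w where "w t = (1 / (2 * pi)) *\<^sub>R (cas t *\<^sub>R A 1 + cas (- t) *\<^sub>R A (- 1))" for t
  have w: "w t = ellipse a (n \<times> a) t" for t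
    unfolding ellipse_def na unfolding a_def w_def cas_def
    by (simp add: scaleR_add_left scaleR_add_right scaleR_diff_left scaleR_diff_right algebra_simps)
  have sqw: "square_integrable w"
    unfolding w_def by (intro continuous_square_integrable continuous_intros)
  have orth: "n \<bullet> a = 0"
    using dot_cross_self(1)[of n "A 1"] dot_cross_self(1)[of n "A (- 1)"]
    by (simp add: A1 A2 a_def inner_add_right)
  have "AE t in period. z t - w t = 0"
  proof (rule AE_eq_zero_componentwise)
    fix c :: "real^3"
    show "AE t in period. c \<bullet> (z t - w t) = 0"
    proof (rule fourier_coefficients_zero_imp_AE_zero)
      show "sq_int (\<lambda>t. c \<bullet> (z t - w t))"
        by (intro square_integrable_component square_integrable_diff sq sqw)
      fix k :: int
      have "(LINT t|period. (c \<bullet> w t) * cas (of_int k * t)) =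
          (LINT t|period. (c \<bullet> A 1) / (2 * pi) * (cas (of_int 1 * t) * cas (of_int k * t)) +
            (c \<bullet> A (- 1)) / (2 * pi) * (cas (of_int (- 1) * t) * cas (of_int k * t)))"
        by (rule Bochner_Integration.integral_cong)
           (simp_all add: w_def inner_add_right field_simps)
      also have "\<dots> = (c \<bullet> A 1) / (2 * pi) * (LINT t|period. cas (of_int 1 * t) * cas (of_int k * t)) +
            (c \<bullet> A (- 1)) / (2 * pi) * (LINT t|period. cas (of_int (- 1) * t) * cas (of_int k * t))"
        by (subst Bochner_Integration.integral_add)
           (intro integrable_mult_right sq_int_mult_integrable sq_int_cas | simp)+
      also have "\<dots> = c \<bullet> A k"
        using A0[of k] by (simp only: LINT_cas_mult) auto
      finally have "(LINT t|period. (c \<bullet> w t) * cas (of_int k * t)) = c \<bullet> A k" .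
      moreover have "(LINT t|period. (c \<bullet> z t) * cas (of_int k * t)) = c \<bullet> A k"
        by (simp add: A_def inner_LINT_scaleR sq sq_int_cas)
      ultimately show "(LINT t|period. c \<bullet> (z t - w t) * cas (of_int k * t)) = 0"
        by (simp add: inner_diff_right left_diff_distrib sq_int_mult_integrable
            square_integrable_component sq sqw sq_int_cas)
    qed
  qed
  then have zw: "AE t in period. z t = ellipse a (n \<times> a) t"
    by (simp add: w)
  have "(LINT t|period. (norm (z' t))\<^sup>2) = (LINT t|period. (norm a)\<^sup>2)"
  proof (rule integral_cong_AE)
    show "AE t in period. (norm (z' t))\<^sup>2 = (norm a)\<^sup>2"
      using eq zw
    proof eventually_elim
      case (elim t)
      have "n \<times> (n \<times> a) = - a"
        using orth n by (simp add: Lagrange norm_eq_1)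
      then have "z' t = cos t *\<^sub>R (n \<times> a) - sin t *\<^sub>R a"
        using elim by (simp add: ellipse_def cross_add_right cross_mult_right)
      then have "(norm (z' t))\<^sup>2 = (cos t)\<^sup>2 * (norm (n \<times> a))\<^sup>2 + (sin t)\<^sup>2 * (norm a)\<^sup>2"
        by (simp add: norm_diff_orthogonal dot_cross_self)
      also have "\<dots> = ((cos t)\<^sup>2 + (sin t)\<^sup>2) * (norm a)\<^sup>2"
        using orth n by (simp add: norm_cross flip: distrib_right)
      finally show ?case by simp
    qed
  qed (use sq in \<open>auto simp: square_integrable_def\<close>)
  then show ?thesis
    using that[OF orth zw] LINT_period_const[of "(norm a)\<^sup>2"] by simp
qed

section \<open>Classical derivatives are weak derivatives\<close>

text \<open>Integration by parts; the boundary terms cancel because f and the test function are both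
  periodic.\<close>

lemma vector_derivative_imp_is_weak_deriv:
  assumes f: "periodic f" "\<And>t. (f has_vector_derivative f' t) (at t)" "continuous_on UNIV f'"
  shows "is_weak_deriv f f'"
  unfolding is_weak_deriv_def
proof (intro allI impI)
  fix \<phi> assume \<phi>: "test_function \<phi>"
  have diff: "(deriv ^^ n) \<phi> differentiable_on UNIV" for n
    using \<phi> by (simp add: test_function_def)
  have d: "(\<phi> has_real_derivative deriv \<phi> t) (at t)" for t
    using diff[of 0] by (simp add: differentiable_on_def DERIV_deriv_iff_real_differentiable)
  have cont: "continuous_on {0..2*pi} \<phi>" "continuous_on {0..2*pi} (deriv \<phi>)"
    using diff[of 0] diff[of 1]
    by (auto intro: continuous_on_subset[OF differentiable_imp_continuous_on])
  have contf: "continuous_on {0..2*pi} f" "continuous_on {0..2*pi} f'"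
    using f(2,3) by (auto intro: continuous_on_subset continuous_at_imp_continuous_on
        has_vector_derivative_continuous)
  have "((\<lambda>t. \<phi> t *\<^sub>R f' t + deriv \<phi> t *\<^sub>R f t) has_integral
      \<phi> (2*pi) *\<^sub>R f (2*pi) - \<phi> 0 *\<^sub>R f 0) {0..2*pi}"
    by (rule fundamental_theorem_of_calculus)
       (auto intro!: has_vector_derivative_scaleR has_field_derivative_at_within[OF d]
          has_vector_derivative_at_within[OF f(2)])
  moreover have "\<phi> (2*pi) = \<phi> 0" "f (2*pi) = f 0"
    using \<phi> f(1) by (auto simp: test_function_def periodic_def dest: spec[of _ 0])
  ultimately have "(LINT t|period. \<phi> t *\<^sub>R f' t + deriv \<phi> t *\<^sub>R f t) = 0"
    by (intro has_integral_imp_LINT_period continuous_intros cont contf) simp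
  moreover have "(LINT t|period. \<phi> t *\<^sub>R f' t + deriv \<phi> t *\<^sub>R f t) =
      (LINT t|period. \<phi> t *\<^sub>R f' t) + (LINT t|period. deriv \<phi> t *\<^sub>R f t)"
    by (intro Bochner_Integration.integral_add continuous_integrable_period continuous_intros cont contf)
  ultimately show "(LINT t|period. deriv \<phi> t *\<^sub>R f t) = - (LINT t|period. \<phi> t *\<^sub>R f' t)"
    by (simp add: eq_neg_iff_add_eq_0 add.commute)
qed

section \<open>Ellipses as elements of the Sobolev space\<close>

lemma continuous_on_ellipse: "continuous_on S (ellipse u v)"
  unfolding ellipse_def by (intro continuous_intros)

lemma ellipse_is_weak_deriv: "is_weak_deriv (ellipse u v) (ellipse v (- u))"
proof (rule vector_derivative_imp_is_weak_deriv)
  show "periodic (ellipse u v)"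
    by (simp add: periodic_def ellipse_def)
  show "(ellipse u v has_vector_derivative ellipse v (- u) t) (at t)" for t
    unfolding ellipse_def by (auto intro!: derivative_eq_intros)
qed (rule continuous_on_ellipse)

lemma ellipse_square_integrable: "square_integrable (ellipse u v)"
  by (rule continuous_square_integrable[OF continuous_on_ellipse])

lemma ellipse_H1per: "ellipse u v \<in> H1per"
proof -
  have "periodic (ellipse u v)"
    by (simp add: periodic_def ellipse_def)
  then show ?thesis
    unfolding H1per_def using ellipse_is_weak_deriv ellipse_square_integrable by blast
qed

lemma fourier_deriv_ellipse: "fourier_deriv (ellipse u v) (ellipse v (- u))"
  by (intro is_weak_deriv_imp_fourier_deriv ellipse_is_weak_deriv ellipse_square_integrable)

lemma fourier_deriv_weak_deriv:
  assumes "\<xi> \<in> H1per" shows "fourier_deriv \<xi> (weak_deriv \<xi>)"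
proof -
  have "\<exists>\<xi>'. square_integrable \<xi>' \<and> is_weak_deriv \<xi> \<xi>'"
    using assms by (simp add: H1per_def)
  then have "square_integrable (weak_deriv \<xi>) \<and> is_weak_deriv \<xi> (weak_deriv \<xi>)"
    unfolding weak_deriv_def by (rule someI_ex)
  then show ?thesis
    using assms by (intro is_weak_deriv_imp_fourier_deriv) (auto simp: H1per_def)
qed

section \<open>Coordinates adapted to the energy\<close>

lemma \<tau>_simps:
  "\<tau> 1 = vector [0, -1, 1]" "\<tau> 2 = (1 / sqrt 3) *\<^sub>R vector [-2, 1, 1]" "\<tau> 3 = vector [1, 1, 1]"
  by (simp_all add: \<tau>_def vector_3)

lemma norm_\<tau>: "norm (\<tau> 1) = sqrt 2" "norm (\<tau> 2) = sqrt 2" "norm (\<tau> 3) = sqrt 3"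
  by (simp_all add: \<tau>_simps norm_eq_sqrt_inner inner_vec_def sum_3 vector_3 real_sqrt_divide)

lemma \<tau>_hat_simps:
  "\<tau>_hat 1 = (1 / sqrt 2) *\<^sub>R vector [0, -1, 1]"
  "\<tau>_hat 2 = (1 / (sqrt 2 * sqrt 3)) *\<^sub>R vector [-2, 1, 1]"
  "\<tau>_hat 3 = (1 / sqrt 3) *\<^sub>R vector [1, 1, 1]"
  by (simp_all add: \<tau>_hat_def norm_\<tau>) (simp_all add: \<tau>_simps)

lemma orthogonal_matrix_U: "orthogonal_matrix U"
proof -
  have "\<tau>_hat i \<bullet> \<tau>_hat j = (if i = j then 1 else 0)" for i j
    using exhaust_3[of i] exhaust_3[of j]
    by (auto simp: \<tau>_hat_simps inner_vec_def sum_3 vector_3 field_simps)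
  then have "transpose U ** U = mat 1"
    by (simp add: matrix_matrix_mult_def transpose_def U_def mat_def vec_eq_iff inner_vec_def)
  then show ?thesis
    by (simp add: orthogonal_matrix)
qed

lemma \<tau>_coords_nth: "\<tau>_coords a $ i = \<tau>_hat i \<bullet> a"
  by (simp add: \<tau>_coords_def matrix_vector_mult_def transpose_def U_def inner_vec_def)

text \<open>An orthogonal matrix preserves cross products up to its determinant, here -1. This is
  the source of the order v \<times> u and of the minus sign in the transformed constraint.\<close>

lemma \<tau>_coords_cross: "\<tau>_coords a \<times> \<tau>_coords b = - \<tau>_coords (a \<times> b)"
proof -
  have "det (transpose U) = - 1"
    by (simp add: det_3 transpose_def U_def \<tau>_hat_simps vector_3 field_simps)
  then show ?thesis
    using cross_orthogonal_matrix[of "transpose U" a b] orthogonal_matrix_U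
    by (simp add: \<tau>_coords_def orthogonal_matrix_transpose)
qed

lemma diag_mult_nth [simp]: "(diag a *v x) $ i = a $ i * x $ i"
  by (simp add: diag_def matrix_vector_mult_def if_distrib[of "\<lambda>y. y * _"] cong: if_cong)

lemma \<gg>_nth [simp]: "\<gg> h \<kappa> $ 1 = \<kappa> - h" "\<gg> h \<kappa> $ 2 = \<kappa> - h" "\<gg> h \<kappa> $ 3 = \<kappa> + 2 * h"
  by (simp_all add: \<gg>_def vector_3)

lemma \<gg>_pos:
  assumes "\<kappa> > max h (- 2 * h)" shows "0 < \<gg> h \<kappa> $ i"
  using exhaust_3[of i] assms by auto

lemma g_coords_nth: "g_coords h \<kappa> a $ i = sqrt (2 * pi) * (sqrt (\<gg> h \<kappa> $ i) * (\<tau>_hat i \<bullet> a))"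
  by (simp add: g_coords_def \<tau>_coords_nth)

lemma linear_g_coords: "linear (g_coords h \<kappa>)"
  by (rule linearI) (simp_all add: vec_eq_iff g_coords_nth inner_add_right algebra_simps)

lemma linear_u_vec: "linear (u_vec h \<kappa>)"
  by (rule linearI)
     (simp_all add: u_vec_def matrix_vector_right_distrib matrix_vector_mult_scaleR scaleR_add_right)

lemma v_vec_eq: "v_vec h \<kappa> \<omega> \<sigma> = u_vec h \<kappa> (\<sigma> \<times> ((1 / norm \<omega>) *\<^sub>R \<omega>))"
  by (simp add: v_vec_def u_vec_def)

text \<open>Together with \<open>u_vec_g_coords\<close> this makes \<open>u_vec\<close> the inverse
  of \<open>g_coords\<close>: the adapted coordinates of u and v are \<sigma> and its cross product
  with the unit vector along \<omega>.\<close>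

lemma g_coords_u_vec:
  assumes "\<kappa> > max h (- 2 * h)" shows "g_coords h \<kappa> (u_vec h \<kappa> x) = x"
proof -
  have "\<tau>_coords ((U ** \<Lambda>_inv_sqrt h \<kappa>) *v x) = \<Lambda>_inv_sqrt h \<kappa> *v x"
    using orthogonal_matrix_U
    by (simp add: \<tau>_coords_def orthogonal_matrix_def matrix_vector_mul_assoc matrix_mul_assoc)
  then have "g_coords h \<kappa> ((U ** \<Lambda>_inv_sqrt h \<kappa>) *v x) = sqrt (2 * pi) *\<^sub>R x"
    using less_imp_neq[OF \<gg>_pos[OF assms]] by (simp add: g_coords_def vec_eq_iff \<Lambda>_inv_sqrt_def)
  then show ?thesis
    by (simp add: u_vec_def linear_scale[OF linear_g_coords])
qed

lemma u_vec_g_coords: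
  assumes "\<kappa> > max h (- 2 * h)" shows "u_vec h \<kappa> (g_coords h \<kappa> x) = x"
proof -
  have "\<Lambda>_inv_sqrt h \<kappa> *v g_coords h \<kappa> x = sqrt (2 * pi) *\<^sub>R \<tau>_coords x"
    using less_imp_neq[OF \<gg>_pos[OF assms]] by (simp add: g_coords_def vec_eq_iff \<Lambda>_inv_sqrt_def)
  then have "(U ** \<Lambda>_inv_sqrt h \<kappa>) *v g_coords h \<kappa> x = sqrt (2 * pi) *\<^sub>R (U *v \<tau>_coords x)"
    by (simp add: matrix_vector_mult_scaleR flip: matrix_vector_mul_assoc)
  moreover have "U *v \<tau>_coords x = x"
    using orthogonal_matrix_U
    by (simp only: \<tau>_coords_def orthogonal_matrix_def matrix_vector_mul_assoc matrix_vector_mul_lid)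
  ultimately show ?thesis
    by (simp add: u_vec_def)
qed

lemma g_inner_\<tau>_coords:
  assumes "\<kappa> > max h (- 2 * h)"
  shows "g_inner h \<kappa> (\<tau>_coords a) (\<tau>_coords b) = g_coords h \<kappa> a \<bullet> g_coords h \<kappa> b"
proof -
  have "sqrt (\<gg> h \<kappa> $ i) * sqrt (\<gg> h \<kappa> $ i) = \<gg> h \<kappa> $ i" for i
    using \<gg>_pos[OF assms, of i] by simp
  moreover have "g_coords h \<kappa> a $ i * g_coords h \<kappa> b $ i = (sqrt (2 * pi) * sqrt (2 * pi)) *
      ((sqrt (\<gg> h \<kappa> $ i) * sqrt (\<gg> h \<kappa> $ i)) * \<tau>_coords a $ i * \<tau>_coords b $ i)" for i
    by (simp only: g_coords_nth \<tau>_coords_nth mult_ac)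
  ultimately have "g_coords h \<kappa> a $ i * g_coords h \<kappa> b $ i =
      2 * pi * (\<gg> h \<kappa> $ i * \<tau>_coords a $ i * \<tau>_coords b $ i)" for i
    by simp
  then show ?thesis
    by (simp add: g_inner_def inner_vec_def sum_distrib_left)
qed

text \<open>The diagonal of the cofactor matrix of the stretching: a diagonal matrix with entries r,
  r, s has cofactors r s, r s, r r.\<close>

definition cross_scale :: "real \<Rightarrow> real \<Rightarrow> real^3" where
  "cross_scale h \<kappa> = (let g = \<gg> h \<kappa> $ 1; g\<^sub>\<theta> = \<gg> h \<kappa> $ 3 in vector [sqrt (g * g\<^sub>\<theta>), sqrt (g * g\<^sub>\<theta>), g])"

lemma cross_scale_pos:
  assumes "\<kappa> > max h (- 2 * h)" shows "0 < cross_scale h \<kappa> $ i"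
  using exhaust_3[of i] \<gg>_pos[OF assms, of 1] \<gg>_pos[OF assms, of 3]
  by (auto simp: cross_scale_def Let_def vector_3)

text \<open>A linear map acts on cross products by its cofactor matrix. The stretching contributes
  \<open>cross_scale\<close>, the two factors \<open>sqrt (2 * pi)\<close> multiply to 2 pi, and the
  frame contributes the sign.\<close>

lemma g_coords_cross:
  assumes "\<kappa> > max h (- 2 * h)"
  shows "g_coords h \<kappa> a \<times> g_coords h \<kappa> b = - (2 * pi) *\<^sub>R (diag (cross_scale h \<kappa>) *v \<tau>_coords (a \<times> b))"
proof -
  define A B where "A = \<tau>_coords a" and "B = \<tau>_coords b"
  define r s where "r = sqrt (\<kappa> - h)" and "s = sqrt (\<kappa> + 2 * h)"
  have rr: "r * r = \<kappa> - h" and rs: "sqrt ((\<kappa> - h) * (\<kappa> + 2 * h)) = r * s"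
    using assms by (simp_all add: r_def s_def real_sqrt_mult)
  have scale: "cross_scale h \<kappa> = vector [r * s, r * s, r * r]"
    by (simp add: cross_scale_def rr rs)
  have "g_coords h \<kappa> a \<times> g_coords h \<kappa> b = (2 * pi) *\<^sub>R
      ((diag (vector [r, r, s]) *v A) \<times> (diag (vector [r, r, s]) *v B))"
  proof -
    have "g_coords h \<kappa> x = sqrt (2 * pi) *\<^sub>R (diag (vector [r, r, s]) *v \<tau>_coords x)" for x
      by (simp add: g_coords_def vec_eq_iff forall_3 r_def s_def vector_3)
    then show ?thesis
      by (simp add: A_def B_def cross_mult_left cross_mult_right)
  qed
  also have "(diag (vector [r, r, s]) *v A) \<times> (diag (vector [r, r, s]) *v B) = diag (cross_scale h \<kappa>) *v (A \<times> B)"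
    by (simp add: vec_eq_iff forall_3 cross_components scale vector_3 algebra_simps)
  also have "A \<times> B = - \<tau>_coords (a \<times> b)"
    by (simp add: A_def B_def \<tau>_coords_cross)
  finally show ?thesis
    by (simp add: vec_eq_iff)
qed

lemma \<omega>_vec_nth:
  "\<omega>_vec h \<kappa> \<alpha> \<gamma> \<delta>p $ i = cross_scale h \<kappa> $ i / \<hh> \<alpha> \<gamma> $ i * \<delta>p $ i"
  using exhaust_3[of i] by (auto simp: \<omega>_vec_def cross_scale_def \<hh>_def Let_def vector_3 norm_\<tau>)

lemma \<hh>_nonzero:
  assumes "\<alpha> \<noteq> 0" "\<gamma> \<noteq> 0" shows "\<hh> \<alpha> \<gamma> $ i \<noteq> 0"
  using exhaust_3[of i] assms by (auto simp: \<hh>_def vector_3 norm_\<tau>)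

lemma \<omega>_vec_eq_0_iff:
  assumes "\<kappa> > max h (- 2 * h)" "\<alpha> \<noteq> 0" "\<gamma> \<noteq> 0"
  shows "\<omega>_vec h \<kappa> \<alpha> \<gamma> \<delta>p = 0 \<longleftrightarrow> \<delta>p = 0"
  using \<hh>_nonzero[OF assms(2,3)] less_imp_neq[OF cross_scale_pos[OF assms(1)]]
  by (simp add: vec_eq_iff \<omega>_vec_nth)

text \<open>Any derivative \<open>\<eta>\<close> may stand in for \<open>weak_deriv \<xi>\<close>,
  so that explicit ellipses can be inserted.\<close>

lemma energy_eq:
  assumes \<kappa>: "\<kappa> > max h (- 2 * h)" and \<xi>: "\<xi> \<in> H1per" "fourier_deriv \<xi> \<eta>"
  shows "(LINT t|period. (norm (g_coords h \<kappa> (\<eta> t)))\<^sup>2) = 2 * pi * energy h \<kappa> \<xi>"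
proof -
  have sq: "square_integrable \<eta>" "square_integrable (weak_deriv \<xi>)"
    using \<xi>(2) fourier_deriv_weak_deriv[OF \<xi>(1)] by (auto simp: fourier_deriv_def)
  have eq: "AE t in period. weak_deriv \<xi> t = \<eta> t"
    by (rule fourier_deriv_unique[OF fourier_deriv_weak_deriv[OF \<xi>(1)] \<xi>(2)])
  have meas: "(\<lambda>t. (c \<bullet> f t)\<^sup>2) \<in> borel_measurable period" if "square_integrable f" for f c
    using square_integrable_component[OF that, of c] unfolding sq_int_def
    by (auto intro: borel_measurable_integrable)
  have "(LINT t|period. (weak_deriv \<xi> t \<bullet> c)\<^sup>2) = (LINT t|period. (c \<bullet> \<eta> t)\<^sup>2)" for c
    unfolding inner_commute[of _ c]
    by (rule integral_cong_AE) (use eq meas sq in auto)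
  then have "2 * pi * energy h \<kappa> \<xi> = 2 * pi * (\<Sum>i\<in>UNIV. \<gg> h \<kappa> $ i * (LINT t|period. (\<tau>_hat i \<bullet> \<eta> t)\<^sup>2))"
    by (simp add: energy_def)
  also have "\<dots> = (LINT t|period. 2 * pi * (\<Sum>i\<in>UNIV. \<gg> h \<kappa> $ i * (\<tau>_hat i \<bullet> \<eta> t)\<^sup>2))"
    using square_integrable_component[OF sq(1)] by (simp add: sq_int_def)
  also have "\<dots> = (LINT t|period. (norm (g_coords h \<kappa> (\<eta> t)))\<^sup>2)"
    by (rule Bochner_Integration.integral_cong)
       (simp_all add: power2_norm_eq_inner flip: g_inner_\<tau>_coords[OF \<kappa>],
        simp add: g_inner_def inner_vec_def \<tau>_coords_nth power2_eq_square mult.assoc)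
  finally show ?thesis by simp
qed

text \<open>The origin of \<open>\<omega>_vec\<close>: solving the constraint for the area divides
  by \<open>\<hh>\<close>, and passing to adapted coordinates multiplies by
  \<open>cross_scale\<close>.\<close>

lemma displacement_eq_iff:
  assumes \<kappa>: "\<kappa> > max h (- 2 * h)" "\<alpha> \<noteq> 0" "\<gamma> \<noteq> 0" and \<xi>: "\<xi> \<in> H1per" "fourier_deriv \<xi> \<eta>"
  shows "displacement \<alpha> \<gamma> \<xi> = \<delta>p \<longleftrightarrow>
    (LINT t|period. g_coords h \<kappa> (\<xi> t) \<times> g_coords h \<kappa> (\<eta> t)) = - (2 * pi) *\<^sub>R \<omega>_vec h \<kappa> \<alpha> \<gamma> \<delta>p"
proof -
  have sq: "square_integrable \<xi>" "square_integrable \<eta>" "square_integrable (weak_deriv \<xi>)"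
    using \<xi>(2) fourier_deriv_weak_deriv[OF \<xi>(1)] by (auto simp: fourier_deriv_def)
  have eq: "AE t in period. weak_deriv \<xi> t = \<eta> t"
    by (rule fourier_deriv_unique[OF fourier_deriv_weak_deriv[OF \<xi>(1)] \<xi>(2)])
  define E where "E = (LINT t|period. \<xi> t \<times> \<eta> t)"
  have E: "(LINT t|period. \<xi> t \<times> weak_deriv \<xi> t) = E"
    unfolding E_def
    by (rule integral_cong_AE)
       (use eq in \<open>auto intro!: borel_measurable_integrable square_integrable_cross_integrable sq\<close>)
  have disp: "displacement \<alpha> \<gamma> \<xi> $ i = \<hh> \<alpha> \<gamma> $ i * (\<tau>_hat i \<bullet> E)" for i
    using exhaust_3[of i] by (auto simp: displacement_def E sum_3 axis_def)
  define L where "L x = - (2 * pi) *\<^sub>R (diag (cross_scale h \<kappa>) *v \<tau>_coords x)" for x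
  have "linear L"
    by (rule linearI) (simp_all add: L_def vec_eq_iff \<tau>_coords_nth inner_add_right algebra_simps)
  then have "bounded_linear L"
    by (simp add: linear_conv_bounded_linear)
  then have "(LINT t|period. L (\<xi> t \<times> \<eta> t)) = L E"
    unfolding E_def by (rule integral_bounded_linear[OF _ square_integrable_cross_integrable[OF sq(1,2)]])
  then have "(LINT t|period. g_coords h \<kappa> (\<xi> t) \<times> g_coords h \<kappa> (\<eta> t)) = L E"
    by (simp add: L_def g_coords_cross[OF \<kappa>(1)])
  moreover have "L E = - (2 * pi) *\<^sub>R \<omega>_vec h \<kappa> \<alpha> \<gamma> \<delta>p \<longleftrightarrow> (\<forall>i. \<tau>_hat i \<bullet> E = \<delta>p $ i / \<hh> \<alpha> \<gamma> $ i)"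
    using less_imp_neq[OF cross_scale_pos[OF \<kappa>(1)]]
    by (simp add: L_def vec_eq_iff \<omega>_vec_nth \<tau>_coords_nth flip: times_divide_eq_right)
  moreover have "displacement \<alpha> \<gamma> \<xi> = \<delta>p \<longleftrightarrow> (\<forall>i. \<tau>_hat i \<bullet> E = \<delta>p $ i / \<hh> \<alpha> \<gamma> $ i)"
    using \<hh>_nonzero[OF \<kappa>(2,3)] by (simp add: vec_eq_iff disp field_simps)
  ultimately show ?thesis
    by simp
qed

section \<open>Vectors generating the optimal ellipses\<close>

lemma linear_ellipse: "linear L \<Longrightarrow> L (ellipse a b t) = ellipse (L a) (L b) t"
  by (simp add: ellipse_def linear_add linear_scale)

text \<open>For orthogonal \<sigma> and \<omega>, \<sigma> \<times> (\<sigma> \<times> \<omega>) is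
  \<omega> times minus the squared norm of \<sigma>, which the normalization equates with
  \<open>norm \<omega>\<close>. If \<omega> = 0, all vectors involved are 0.\<close>

lemma generator_cross:
  assumes "generator \<omega> \<sigma>"
  defines "\<rho> \<equiv> \<sigma> \<times> ((1 / norm \<omega>) *\<^sub>R \<omega>)"
  shows "\<rho> \<times> \<sigma> = \<omega>" "\<sigma> \<bullet> \<rho> = 0" "(norm \<rho>)\<^sup>2 = norm \<omega>"
proof -
  have orth: "\<sigma> \<bullet> \<omega> = 0" and norm: "(norm \<sigma>)\<^sup>2 = norm \<omega>"
    using assms(1) by (auto simp: generator_def)
  have "\<sigma> \<times> (\<sigma> \<times> \<omega>) = - (norm \<omega> *\<^sub>R \<omega>)"
    using orth norm by (simp add: Lagrange power2_norm_eq_inner)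
  then have "\<sigma> \<times> \<rho> = - \<omega>"
    by (cases "\<omega> = 0") (simp_all add: \<rho>_def cross_mult_right)
  then show "\<rho> \<times> \<sigma> = \<omega>"
    by (subst cross_skew) simp
  show "\<sigma> \<bullet> \<rho> = 0"
    by (simp add: \<rho>_def dot_cross_self)
  show "(norm \<rho>)\<^sup>2 = norm \<omega>"
    using orth norm by (cases "\<omega> = 0") (simp_all add: \<rho>_def norm_cross)
qed

lemma generator_exists: "\<exists>\<sigma>. generator \<omega> \<sigma>"
proof -
  obtain x where x: "x \<noteq> 0" "orthogonal \<omega> x"
    using orthogonal_to_vector_exists[of \<omega>] by auto
  then have "generator \<omega> ((sqrt (norm \<omega>) / norm x) *\<^sub>R x)"
    by (auto simp: generator_def orthogonal_def inner_commute power_mult_distrib power_divide)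
  then show ?thesis ..
qed

lemma generator_of_independent:
  assumes "\<mu> \<noteq> \<omega>" "independent {\<mu>, \<omega>}"
  shows "generator \<omega> ((sqrt (norm \<omega>) / norm (\<mu> \<times> \<omega>)) *\<^sub>R (\<mu> \<times> \<omega>))"
proof -
  have "\<mu> \<times> \<omega> \<noteq> 0"
  proof
    assume "\<mu> \<times> \<omega> = 0"
    then consider "\<mu> = 0" | "\<omega> = 0" | c where "\<omega> = c *\<^sub>R \<mu>"
      by (auto simp: cross_eq_0 collinear_lemma)
    then have "dependent {\<mu>, \<omega>}"
    proof cases
      case 3
      then have "\<omega> \<in> span ({\<mu>, \<omega>} - {\<omega>})"
        using assms(1) by (simp add: insert_Diff_if span_base span_scale)
      then show ?thesis
        unfolding dependent_def by blast
    qed (simp_all add: dependent_zero)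
    then show False using assms(2) by simp
  qed
  then show ?thesis
    by (simp add: generator_def dot_cross_self power_mult_distrib power_divide)
qed

text \<open>\<sigma> and \<rho> are nonzero and orthogonal, hence independent, and
  \<open>u_vec\<close> is injective because \<open>g_coords\<close> inverts it.\<close>

lemma dim_generator:
  assumes \<kappa>: "\<kappa> > max h (- 2 * h)" and \<sigma>: "generator \<omega> \<sigma>" and \<omega>: "\<omega> \<noteq> 0"
  shows "dim {u_vec h \<kappa> \<sigma>, v_vec h \<kappa> \<omega> \<sigma>} = 2"
proof -
  define \<rho> where "\<rho> = \<sigma> \<times> ((1 / norm \<omega>) *\<^sub>R \<omega>)"
  note \<rho> = generator_cross[OF \<sigma>, folded \<rho>_def]
  have nz: "\<sigma> \<noteq> 0" "\<rho> \<noteq> 0"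
    using \<rho>(1) \<omega> by auto
  then have "\<sigma> \<noteq> \<rho>"
    using \<rho>(2) by auto
  have "independent {\<sigma>, \<rho>}"
    using nz \<rho>(2) by (intro pairwise_orthogonal_independent)
      (auto simp: pairwise_def orthogonal_def inner_commute)
  then have "dim {\<sigma>, \<rho>} = 2"
    using \<open>\<sigma> \<noteq> \<rho>\<close> by (simp add: dim_eq_card_independent)
  moreover have "inj (u_vec h \<kappa>)"
    by (rule inj_on_inverseI[of _ "g_coords h \<kappa>"]) (rule g_coords_u_vec[OF \<kappa>])
  then have "dim (u_vec h \<kappa> ` {\<sigma>, \<rho>}) = dim {\<sigma>, \<rho>}"
    by (intro dim_image_eq linear_u_vec) (rule inj_on_subset, auto)
  ultimately show ?thesis
    by (simp add: v_vec_eq \<rho>_def)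
qed

section \<open>Optimality of the ellipses\<close>

text \<open>In adapted coordinates the ellipse is a circle with orthogonal radii \<sigma> and
  \<rho>. Its speed and its cross product with the velocity are constant in t, so both integrals are
  2 pi times a constant.\<close>

lemma ellipse_admissible:
  assumes \<kappa>: "\<kappa> > max h (- 2 * h)" "\<alpha> \<noteq> 0" "\<gamma> \<noteq> 0"
    and \<omega>: "\<omega> = \<omega>_vec h \<kappa> \<alpha> \<gamma> \<delta>p" and \<sigma>: "generator \<omega> \<sigma>"
  defines "\<xi> \<equiv> ellipse (u_vec h \<kappa> \<sigma>) (v_vec h \<kappa> \<omega> \<sigma>)"
  shows "\<xi> \<in> admissible \<alpha> \<gamma> \<delta>p" "energy h \<kappa> \<xi> = norm \<omega>"
proof -
  define \<rho> where "\<rho> = \<sigma> \<times> ((1 / norm \<omega>) *\<^sub>R \<omega>)"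
  note \<rho> = generator_cross[OF \<sigma>, folded \<rho>_def]
  define \<eta> where "\<eta> = ellipse (v_vec h \<kappa> \<omega> \<sigma>) (- u_vec h \<kappa> \<sigma>)"
  have \<xi>: "\<xi> \<in> H1per" "fourier_deriv \<xi> \<eta>"
    unfolding \<xi>_def \<eta>_def by (rule ellipse_H1per, rule fourier_deriv_ellipse)
  have g\<xi>: "g_coords h \<kappa> (\<xi> t) = cos t *\<^sub>R \<sigma> + sin t *\<^sub>R \<rho>" for t
    unfolding \<xi>_def linear_ellipse[OF linear_g_coords] v_vec_eq g_coords_u_vec[OF \<kappa>(1)]
    by (simp add: ellipse_def \<rho>_def)
  have g\<eta>: "g_coords h \<kappa> (\<eta> t) = cos t *\<^sub>R \<rho> - sin t *\<^sub>R \<sigma>" for t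
    unfolding \<eta>_def linear_ellipse[OF linear_g_coords] linear_neg[OF linear_g_coords] v_vec_eq
      g_coords_u_vec[OF \<kappa>(1)]
    by (simp add: ellipse_def \<rho>_def)
  have "g_coords h \<kappa> (\<xi> t) \<times> g_coords h \<kappa> (\<eta> t) = - \<omega>" for t
  proof -
    have "g_coords h \<kappa> (\<xi> t) \<times> g_coords h \<kappa> (\<eta> t) = ((cos t)\<^sup>2 + (sin t)\<^sup>2) *\<^sub>R (\<sigma> \<times> \<rho>)"
    proof -
      have "(c *\<^sub>R \<sigma> + s *\<^sub>R \<rho>) \<times> (c *\<^sub>R \<rho> - s *\<^sub>R \<sigma>) = (c\<^sup>2 + s\<^sup>2) *\<^sub>R (\<sigma> \<times> \<rho>)" for c s
        by (simp add: vec_eq_iff forall_3 cross_components power2_eq_square algebra_simps)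
      then show ?thesis
        by (simp only: g\<xi> g\<eta>)
    qed
    then show ?thesis
      using \<rho>(1) cross_skew[of \<sigma> \<rho>] by simp
  qed
  then have "displacement \<alpha> \<gamma> \<xi> = \<delta>p"
    using displacement_eq_iff[OF \<kappa> \<xi>, of \<delta>p] LINT_period_const[of "- \<omega>"] \<omega> by simp
  then show "\<xi> \<in> admissible \<alpha> \<gamma> \<delta>p"
    using \<xi>(1) by (simp add: admissible_def)
  have "(norm (g_coords h \<kappa> (\<eta> t)))\<^sup>2 = norm \<omega>" for t
  proof -
    have "(norm (g_coords h \<kappa> (\<eta> t)))\<^sup>2 = (cos t)\<^sup>2 * (norm \<rho>)\<^sup>2 + (sin t)\<^sup>2 * (norm \<sigma>)\<^sup>2"
      using \<rho>(2) by (simp add: g\<eta> norm_diff_orthogonal inner_commute)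
    also have "\<dots> = ((cos t)\<^sup>2 + (sin t)\<^sup>2) * norm \<omega>"
      using \<rho>(3) \<sigma> by (simp add: generator_def flip: distrib_right)
    finally show ?thesis by simp
  qed
  then show "energy h \<kappa> \<xi> = norm \<omega>"
    using energy_eq[OF \<kappa>(1) \<xi>] LINT_period_const[of "norm \<omega>"] by simp
qed

text \<open>The direction along which the prescribed area, -2 pi times \<omega>, is nonnegative. For
  \<omega> = 0 any unit vector serves, so the isoperimetric inequality covers that case too.\<close>

lemma unit_vector_opposite:
  fixes \<omega> :: "real^3"
  obtains n where "norm n = 1" "\<omega> = - norm \<omega> *\<^sub>R n"
proof (cases "\<omega> = 0")
  case True
  then show ?thesis
    using that[of "axis 1 1"] by (simp add: norm_axis_1)
next
  case False
  then show ?thesis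
    using that[of "- (1 / norm \<omega>) *\<^sub>R \<omega>"] by simp
qed

text \<open>The isoperimetric inequality in the direction \<open>n\<close> for the adapted
  coordinates; in the equality case the radius \<open>a\<close> of the resulting circle is itself
  the generator.\<close>

lemma admissible_energy_bound:
  assumes \<kappa>: "\<kappa> > max h (- 2 * h)" "\<alpha> \<noteq> 0" "\<gamma> \<noteq> 0"
    and \<omega>: "\<omega> = \<omega>_vec h \<kappa> \<alpha> \<gamma> \<delta>p" and \<xi>: "\<xi> \<in> admissible \<alpha> \<gamma> \<delta>p"
  shows "norm \<omega> \<le> energy h \<kappa> \<xi>"
    and "energy h \<kappa> \<xi> = norm \<omega> \<Longrightarrow> \<exists>\<sigma>. generator \<omega> \<sigma> \<and>
      (AE t in period. \<xi> t - mean \<xi> = ellipse (u_vec h \<kappa> \<sigma>) (v_vec h \<kappa> \<omega> \<sigma>) t)"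
proof -
  obtain n where n: "norm n = 1" "\<omega> = - norm \<omega> *\<^sub>R n"
    by (rule unit_vector_opposite)
  have H1: "\<xi> \<in> H1per" and disp: "displacement \<alpha> \<gamma> \<xi> = \<delta>p"
    using \<xi> by (auto simp: admissible_def)
  note fd = fourier_deriv_weak_deriv[OF H1]
  define y y' where "y t = g_coords h \<kappa> (\<xi> t)" and "y' t = g_coords h \<kappa> (weak_deriv \<xi> t)" for t
  have y: "fourier_deriv y y'"
    unfolding y_def y'_def by (rule fourier_deriv_linear[OF fd linear_g_coords])
  have area: "n \<bullet> (LINT t|period. y t \<times> y' t) = 2 * pi * norm \<omega>"
  proof -
    have "(LINT t|period. y t \<times> y' t) = - (2 * pi) *\<^sub>R \<omega>"
      using displacement_eq_iff[OF \<kappa> H1 fd, of \<delta>p] disp by (simp add: y_def y'_def \<omega>)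
    also have "n \<bullet> \<dots> = 2 * pi * (norm \<omega> * (n \<bullet> n))"
      by (subst n(2)) simp
    finally show ?thesis
      using n(1) by (simp add: norm_eq_1)
  qed
  have en: "(LINT t|period. (norm (y' t))\<^sup>2) = 2 * pi * energy h \<kappa> \<xi>"
    unfolding y'_def by (rule energy_eq[OF \<kappa>(1) H1 fd])
  show "norm \<omega> \<le> energy h \<kappa> \<xi>"
    using isoperimetric(1)[OF y n(1)] by (simp add: area en)
  assume eq: "energy h \<kappa> \<xi> = norm \<omega>"
  define z where "z t = y t - mean y" for t
  have ae: "AE t in period. y' t = n \<times> z t"
    using isoperimetric(2)[OF y n(1)] by (simp add: area en eq z_def)
  have z: "fourier_deriv z y'" "(LINT t|period. z t) = 0"
    unfolding z_def by (rule fourier_deriv_diff_const[OF y], rule LINT_minus_mean)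
      (use y in \<open>simp add: fourier_deriv_def\<close>)
  obtain a where a: "n \<bullet> a = 0" "AE t in period. z t = ellipse a (n \<times> a) t"
      "(LINT t|period. (norm (y' t))\<^sup>2) = 2 * pi * (norm a)\<^sup>2"
    using rotation_solution[OF z n(1) ae] by blast
  have norm_a: "(norm a)\<^sup>2 = norm \<omega>"
    using a(3) by (simp add: en eq)
  have gen: "generator \<omega> a"
    unfolding generator_def
  proof
    show "a \<bullet> \<omega> = 0"
      using a(1) by (subst n(2)) (simp add: inner_commute)
  qed (rule norm_a)
  \<comment> \<open>As \<open>n\<close> is opposite to \<omega>, rotating about \<open>n\<close>
    from the left is the cross product with the unit vector along \<omega> from the right. For
    \<omega> = 0 both sides vanish because \<open>a\<close> is 0.\<close>
  have cross: "a \<times> ((1 / norm \<omega>) *\<^sub>R \<omega>) = n \<times> a"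
  proof (cases "\<omega> = 0")
    case True
    then show ?thesis using norm_a by simp
  next
    case False
    have "(1 / norm \<omega>) *\<^sub>R \<omega> = (1 / norm \<omega>) *\<^sub>R (- norm \<omega> *\<^sub>R n)"
      by (subst (2) n(2)) simp
    then have "(1 / norm \<omega>) *\<^sub>R \<omega> = - n"
      using False by simp
    then show ?thesis
      by (simp add: cross_skew[of n a])
  qed
  have "square_integrable \<xi>"
    using fd by (simp add: fourier_deriv_def)
  then have mean: "mean y = g_coords h \<kappa> (mean \<xi>)"
    using integral_bounded_linear[OF _ square_integrable_integrable, of "g_coords h \<kappa>" \<xi>] linear_g_coords[of h \<kappa>]
    by (simp add: mean_def y_def linear_conv_bounded_linear linear_scale)
  have "AE t in period. \<xi> t - mean \<xi> = ellipse (u_vec h \<kappa> a) (v_vec h \<kappa> \<omega> a) t"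
    using a(2)
  proof eventually_elim
    case (elim t)
    have "\<xi> t - mean \<xi> = u_vec h \<kappa> (z t)"
      by (simp add: z_def y_def mean u_vec_g_coords[OF \<kappa>(1)] flip: linear_diff[OF linear_g_coords])
    then show ?case
      using elim by (simp add: linear_ellipse[OF linear_u_vec] v_vec_eq cross)
  qed
  then show "\<exists>\<sigma>. generator \<omega> \<sigma> \<and>
      (AE t in period. \<xi> t - mean \<xi> = ellipse (u_vec h \<kappa> \<sigma>) (v_vec h \<kappa> \<omega> \<sigma>) t)"
    using gen by blast
qed

theorem theorem12:
  fixes h \<kappa> \<alpha> \<gamma> :: real and \<delta>p \<omega> :: "real^3" and u v :: "real^3 \<Rightarrow> real^3"
  assumes "\<kappa> > max h (- 2 * h)" and "\<alpha> \<noteq> 0" and "\<gamma> \<noteq> 0"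
  assumes "\<omega> = \<omega>_vec h \<kappa> \<alpha> \<gamma> \<delta>p"
    and "\<And>\<sigma>. u \<sigma> = u_vec h \<kappa> \<sigma>"
    and "\<And>\<sigma>. v \<sigma> = v_vec h \<kappa> \<omega> \<sigma>"
  shows
    "(\<forall>\<xi>. is_minimizer h \<kappa> \<alpha> \<gamma> \<delta>p \<xi> \<longrightarrow>
        (\<exists>\<sigma>. generator \<omega> \<sigma> \<and> (AE t in period. \<xi> t - mean \<xi> = ellipse (u \<sigma>) (v \<sigma>) t))) \<and>
     (\<forall>\<sigma>. generator \<omega> \<sigma> \<longrightarrow> is_minimizer h \<kappa> \<alpha> \<gamma> \<delta>p (ellipse (u \<sigma>) (v \<sigma>))) \<and>
     (\<forall>\<mu>. \<mu> \<noteq> \<omega> \<and> independent {\<mu>, \<omega>} \<longrightarrow>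
        generator \<omega> ((sqrt (norm \<omega>) / norm (\<mu> \<times> \<omega>)) *\<^sub>R (\<mu> \<times> \<omega>))) \<and>
     norm \<omega> \<in> energy h \<kappa> ` admissible \<alpha> \<gamma> \<delta>p \<and>
     (\<forall>\<xi>\<in>admissible \<alpha> \<gamma> \<delta>p. norm \<omega> \<le> energy h \<kappa> \<xi>) \<and>
     (\<forall>\<sigma>. generator \<omega> \<sigma> \<longrightarrow>
        (\<delta>p \<noteq> 0 \<longrightarrow> dim {u \<sigma>, v \<sigma>} = 2) \<and>
        g_coords h \<kappa> (v \<sigma>) \<times> g_coords h \<kappa> (u \<sigma>) = \<omega> \<and>
        g_inner h \<kappa> (\<tau>_coords (u \<sigma>)) (\<tau>_coords (v \<sigma>)) = 0 \<and>
        (g_norm h \<kappa> (\<tau>_coords (u \<sigma>)))\<^sup>2 = norm \<omega> \<and>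
        (g_norm h \<kappa> (\<tau>_coords (v \<sigma>)))\<^sup>2 = norm \<omega>)"
proof -
  note u = assms(5) and v = assms(6)
  note ellipse = ellipse_admissible[OF assms(1-4), folded u v]
  note bound = admissible_energy_bound[OF assms(1-4), folded u v]
  obtain \<sigma>\<^sub>0 where \<sigma>\<^sub>0: "generator \<omega> \<sigma>\<^sub>0"
    using generator_exists by blast
  have attained: "norm \<omega> \<in> energy h \<kappa> ` admissible \<alpha> \<gamma> \<delta>p"
    using ellipse[OF \<sigma>\<^sub>0] by (metis image_eqI)
  have "\<exists>\<sigma>. generator \<omega> \<sigma> \<and> (AE t in period. \<xi> t - mean \<xi> = ellipse (u \<sigma>) (v \<sigma>) t)"
    if "is_minimizer h \<kappa> \<alpha> \<gamma> \<delta>p \<xi>" for \<xi>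
  proof -
    \<comment> \<open>A minimizer does at least as well as the ellipse of
      \<open>\<sigma>\<^sub>0\<close>; with the lower bound this gives equality, so the equality
      case applies.\<close>
    have "\<xi> \<in> admissible \<alpha> \<gamma> \<delta>p" "energy h \<kappa> \<xi> \<le> norm \<omega>"
      using that attained by (auto simp: is_minimizer_def)
    then show ?thesis
      using bound by (intro bound(2)) (auto intro: antisym)
  qed
  moreover have "is_minimizer h \<kappa> \<alpha> \<gamma> \<delta>p (ellipse (u \<sigma>) (v \<sigma>))" if "generator \<omega> \<sigma>" for \<sigma>
    using ellipse[OF that] bound(1) by (simp add: is_minimizer_def)
  moreover have "(\<delta>p \<noteq> 0 \<longrightarrow> dim {u \<sigma>, v \<sigma>} = 2) \<and>
        g_coords h \<kappa> (v \<sigma>) \<times> g_coords h \<kappa> (u \<sigma>) = \<omega> \<and>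
        g_inner h \<kappa> (\<tau>_coords (u \<sigma>)) (\<tau>_coords (v \<sigma>)) = 0 \<and>
        (g_norm h \<kappa> (\<tau>_coords (u \<sigma>)))\<^sup>2 = norm \<omega> \<and>
        (g_norm h \<kappa> (\<tau>_coords (v \<sigma>)))\<^sup>2 = norm \<omega>" if \<sigma>: "generator \<omega> \<sigma>" for \<sigma>
  proof -
    define \<rho> where "\<rho> = \<sigma> \<times> ((1 / norm \<omega>) *\<^sub>R \<omega>)"
    note \<rho> = generator_cross[OF \<sigma>, folded \<rho>_def]
    have coords: "g_coords h \<kappa> (u \<sigma>) = \<sigma>" "g_coords h \<kappa> (v \<sigma>) = \<rho>"
      by (simp_all only: u v v_vec_eq \<rho>_def g_coords_u_vec[OF assms(1)])
    have "dim {u \<sigma>, v \<sigma>} = 2" if "\<delta>p \<noteq> 0"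
      using dim_generator[OF assms(1) \<sigma>] \<omega>_vec_eq_0_iff[OF assms(1-3), of \<delta>p] that
      by (simp add: u v assms(4))
    moreover have "(norm \<sigma>)\<^sup>2 = norm \<omega>"
      using \<sigma> by (simp add: generator_def)
    ultimately show ?thesis
      using \<rho> by (simp add: g_norm_def g_inner_\<tau>_coords[OF assms(1)] coords power2_norm_eq_inner)
  qed
  ultimately show ?thesis
    using attained bound(1) generator_of_independent by blast
qed

end
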